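(* Let $I$ be a left ideal of $\mathcal{D}$. The following are equivalent: 1. $\mathcal{D}/I$ is a finitely generated $\mathcal{H}$-module. 2. For each $i=1,\ldots,n$ there exists $a_i\in\mathbb{N}$ such that $\alpha(i)=a_i\epsilon_i\in\mathrm{Exp}^\delta(I)$ and $C(\alpha(i);I)=\mathcal{H}$, where $\epsilon_i$ is the $i$-th element of the canonical base of $\mathbb{N}^n$.
   Context: $\mathbf{k}$ is a field of characteristic zero, $n\ge 1$, $m\ge 0$, and $\mathbf{k}((\tilde X))$ is the fraction field of the formal power series ring $\mathbf{k}[[x_1,\ldots,x_{n+m}]]$. $\mathcal{H}\subset \mathbf{k}((\tilde X))$ is a noetherian $\mathbf{k}$-subalgebra stable under the partial derivatives $\partial_1,\ldots,\partial_n$ (with respect to $x_1,\ldots,x_n$). It is also assumed to be effective: (1) for any finite subset $\{f_1,\ldots,f_r\}\subset\mathcal{H}$ and $f\in\mathcal{H}$ one can decide whether $f$ lies in the ideal generated by $f_1,\ldots,f_r$ and, if so, find $q_i\in\mathcal{H}$ with $f=\sum q_if_i$; (2) for any finite subset of $\mathcal{H}$ one can find a system of generators of its $\mathcal{H}$-module of syzygies. $\mathcal{D}=\mathcal{H}[\partial]=\mathcal{H}[\partial_1,\ldots,\partial_n]$ is the ring of linear differential operators generated by $\mathcal{H}$ and $\partial_1,\ldots,\partial_n$; its elements are the finite sums $\sum_{\alpha\in\mathbb{N}^n}p_\alpha\partial^\alpha$ with $p_\alpha\in\mathcal{H}$ (unique expression), $0\in\mathbb{N}$. $\mathcal{D}/I$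 is regarded as a left $\mathcal{H}$-module. Fix a (total) well-ordering $<$ on $\mathbb{N}^n$ compatible with the sum: $\alpha+\gamma<\beta+\gamma$ iff $\alpha<\beta$. For nonzero $P=\sum p_\alpha\partial^\alpha\in\mathcal{D}$, $\exp^\delta(P)=\max_<\{\alpha: p_\alpha\ne 0\}$ and $c^\delta(P)=p_{\exp^\delta(P)}\in\mathcal{H}$. For a left ideal $I$ of $\mathcal{D}$, $\mathrm{Exp}^\delta(I)=\{\exp^\delta(P):P\in I\setminus\{0\}\}\subseteq\mathbb{N}^n$ (empty if $I=0$). For $\alpha\in\mathbb{N}^n$, $C(\alpha;I)$ is the ideal of $\mathcal{H}$ generated by $\{c^\delta(P):P\in I\setminus\{0\},\ \alpha\in\exp^\delta(P)+\mathbb{N}^n\}$ ($\{0\}$ if this set is empty). *)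

theory Defs
  imports
    "HOL-Analysis.Finite_Cartesian_Product"
    "HOL-Algebra.Algebraic_Closure_Type"
    "HOL-Algebra.Generated_Rings"
    "HOL-Computational_Algebra.Fraction_Field"
begin

section \<open>Formal power series in finitely many variables\<close>

text \<open>
  The variables are indexed by the finite type \<open>'v\<close>, so there are \<open>CARD('v)\<close> of them; monomials are
  identified with their exponents in \<open>nat ^ 'v\<close>.
\<close>

typedef ('a, 'v) mfps = "UNIV :: (nat ^ 'v::finite \<Rightarrow> 'a) set"
  morphisms mfps_nth Abs_mfps ..

setup_lifting type_definition_mfps

lemma mfps_eqI: "(\<And>\<alpha>. mfps_nth f \<alpha> = mfps_nth g \<alpha>) \<Longrightarrow> f = g"
  by transfer auto

definition splits :: "nat ^ 'v::finite \<Rightarrow> ((nat ^ 'v) \<times> (nat ^ 'v)) set"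
  where "splits \<alpha> = {(\<beta>, \<gamma>). \<beta> + \<gamma> = \<alpha>}"

lemma finite_splits [simp]: "finite (splits \<alpha>)"
proof -
  let ?B = "vec_lambda ` (PiE UNIV (\<lambda>i. {..\<alpha> $ i}))"
  have "\<beta> \<in> ?B" if "\<forall>i. \<beta> $ i \<le> \<alpha> $ i" for \<beta>
    using that by (intro image_eqI[of _ _ "vec_nth \<beta>"]) auto
  then have "splits \<alpha> \<subseteq> ?B \<times> ?B"
    by (auto simp: splits_def)
  then show ?thesis
    by (rule finite_subset) (intro finite_cartesian_product finite_imageI finite_PiE, auto)
qed

lemma splits_zero: "splits 0 = {(0, 0)}"
  by (auto simp: splits_def vec_eq_iff)

instantiation mfps :: (ab_group_add, finite) ab_group_add
begin

lift_definition zero_mfps :: "('a, 'b) mfps" is "\<lambda>_. 0" .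
lift_definition plus_mfps :: "('a, 'b) mfps \<Rightarrow> ('a, 'b) mfps \<Rightarrow> ('a, 'b) mfps"
  is "\<lambda>f g \<alpha>. f \<alpha> + g \<alpha>" .
lift_definition uminus_mfps :: "('a, 'b) mfps \<Rightarrow> ('a, 'b) mfps" is "\<lambda>f \<alpha>. - f \<alpha>" .
lift_definition minus_mfps :: "('a, 'b) mfps \<Rightarrow> ('a, 'b) mfps \<Rightarrow> ('a, 'b) mfps"
  is "\<lambda>f g \<alpha>. f \<alpha> - g \<alpha>" .

instance
  by standard (transfer, simp add: fun_eq_iff algebra_simps)+

end

lift_definition mfps_const :: "'a::zero \<Rightarrow> ('a, 'v::finite) mfps"
  is "\<lambda>c \<alpha>. if \<alpha> = 0 then c else 0" .

instantiation mfps :: (comm_ring_1, finite) comm_ring_1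
begin

lift_definition one_mfps :: "('a, 'b) mfps" is "\<lambda>\<alpha>. if \<alpha> = 0 then 1 else 0" .
lift_definition times_mfps :: "('a, 'b) mfps \<Rightarrow> ('a, 'b) mfps \<Rightarrow> ('a, 'b) mfps"
  is "\<lambda>f g \<alpha>. \<Sum>(\<beta>, \<gamma>)\<in>splits \<alpha>. f \<beta> * g \<gamma>" .

instance
proof
  fix f g h :: "('a, 'b) mfps"
  show "f * g * h = f * (g * h)"
  proof (transfer, rule ext)
    fix f g h :: "nat ^ 'b \<Rightarrow> 'a" and \<alpha> :: "nat ^ 'b"
    have "(\<Sum>(\<beta>, \<gamma>)\<in>splits \<alpha>. (\<Sum>(\<beta>, \<gamma>)\<in>splits \<beta>. f \<beta> * g \<gamma>) * h \<gamma>) =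
        (\<Sum>(x, y)\<in>Sigma (splits \<alpha>) (\<lambda>x. splits (fst x)). f (fst y) * g (snd y) * h (snd x))"
      by (subst sum.Sigma[symmetric]) (auto simp: case_prod_unfold sum_distrib_right)
    also have "\<dots> = (\<Sum>(x, y)\<in>Sigma (splits \<alpha>) (\<lambda>x. splits (snd x)). f (fst x) * (g (fst y) * h (snd y)))"
      by (rule sum.reindex_bij_witness
          [of _ "\<lambda>((b, c), (d, e)). ((b + d, e), (b, d))" "\<lambda>((b, c), (d, e)). ((d, e + c), (e, c))"])
        (auto simp: splits_def algebra_simps)
    also have "\<dots> = (\<Sum>(\<beta>, \<gamma>)\<in>splits \<alpha>. f \<beta> * (\<Sum>(\<beta>, \<gamma>)\<in>splits \<gamma>. g \<beta> * h \<gamma>))"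
      by (subst sum.Sigma[symmetric]) (auto simp: case_prod_unfold sum_distrib_left)
    finally show "(\<Sum>(\<beta>, \<gamma>)\<in>splits \<alpha>. (\<Sum>(\<beta>, \<gamma>)\<in>splits \<beta>. f \<beta> * g \<gamma>) * h \<gamma>) =
        (\<Sum>(\<beta>, \<gamma>)\<in>splits \<alpha>. f \<beta> * (\<Sum>(\<beta>, \<gamma>)\<in>splits \<gamma>. g \<beta> * h \<gamma>))" .
  qed
  show "f * g = g * f"
    by (transfer, rule ext, rule sum.reindex_bij_witness[of _ prod.swap prod.swap])
      (auto simp: splits_def algebra_simps)
  show "1 * f = f"
  proof (transfer, rule ext)
    fix f :: "nat ^ 'b \<Rightarrow> 'a" and \<alpha> :: "nat ^ 'b"
    have "(\<Sum>(\<beta>, \<gamma>)\<in>splits \<alpha>. (if \<beta> = 0 then 1 else 0) * f \<gamma>) =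
        (\<Sum>(\<beta>, \<gamma>)\<in>{(0 :: nat ^ 'b, \<alpha>)}. (if \<beta> = 0 then 1 else 0) * f \<gamma>)"
      by (rule sum.mono_neutral_right, simp, simp add: splits_def)
        (auto simp: splits_def split: if_splits)
    then show "(\<Sum>(\<beta>, \<gamma>)\<in>splits \<alpha>. (if \<beta> = 0 then 1 else 0) * f \<gamma>) = f \<alpha>"
      by simp
  qed
  show "(f + g) * h = f * h + g * h"
    by (transfer, rule ext) (simp add: case_prod_unfold algebra_simps sum.distrib)
  show "(0 :: ('a, 'b) mfps) \<noteq> 1"
    by transfer (metis zero_neq_one)
qed

end

lemma mfps_nth_mult: "mfps_nth (f * g) \<alpha> = (\<Sum>(\<beta>, \<gamma>)\<in>splits \<alpha>. mfps_nth f \<beta> * mfps_nth g \<gamma>)"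
  by transfer simp

lemma exists_extremal_pair:
  fixes A B :: "(nat ^ 'v::finite) set"
  assumes "finite S" "A \<noteq> {}" "B \<noteq> {}"
  shows "\<exists>\<alpha>\<in>A. \<exists>\<beta>\<in>B. \<forall>a\<in>A. \<forall>b\<in>B. a + b = \<alpha> + \<beta> \<longrightarrow> (\<forall>i\<in>S. a $ i = \<alpha> $ i \<and> b $ i = \<beta> $ i)"
  using assms
proof (induction S arbitrary: A B rule: finite_induct)
  case empty
  then show ?case by auto
next
  case (insert x S)
  obtain a0 where a0: "a0 \<in> A" "\<And>a. a \<in> A \<Longrightarrow> a0 $ x \<le> a $ x"
    using ex_has_least_nat[of "\<lambda>a. a \<in> A" _ "\<lambda>a. a $ x"] insert.prems(1) by blast
  obtain b0 where b0: "b0 \<in> B" "\<And>b. b \<in> B \<Longrightarrow> b0 $ x \<le> b $ x"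
    using ex_has_least_nat[of "\<lambda>b. b \<in> B" _ "\<lambda>b. b $ x"] insert.prems(2) by blast
  define p q where "p = a0 $ x" and "q = b0 $ x"
  have p: "\<And>a. a \<in> A \<Longrightarrow> p \<le> a $ x" and q: "\<And>b. b \<in> B \<Longrightarrow> q \<le> b $ x"
    using a0 b0 by (simp_all add: p_def q_def)
  have "{a \<in> A. a $ x = p} \<noteq> {}" "{b \<in> B. b $ x = q} \<noteq> {}"
    using a0(1) b0(1) by (auto simp: p_def q_def)
  from insert.IH[OF this] obtain \<alpha> \<beta> where ab': "\<alpha> \<in> {a \<in> A. a $ x = p}" "\<beta> \<in> {b \<in> B. b $ x = q}"
    and *: "\<forall>a\<in>{a \<in> A. a $ x = p}. \<forall>b\<in>{b \<in> B. b $ x = q}. a + b = \<alpha> + \<beta> \<longrightarrow>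
        (\<forall>i\<in>S. a $ i = \<alpha> $ i \<and> b $ i = \<beta> $ i)"
    by (elim bexE)
  from ab' have ab: "\<alpha> \<in> A" "\<alpha> $ x = p" "\<beta> \<in> B" "\<beta> $ x = q"
    by simp_all
  show ?case
  proof (intro bexI[OF _ ab(1)] bexI[OF _ ab(3)] ballI impI)
    fix a b i assume ab': "a \<in> A" "b \<in> B" "a + b = \<alpha> + \<beta>" "i \<in> insert x S"
    have "a $ x + b $ x = p + q"
      using arg_cong[OF ab'(3), of "\<lambda>v. v $ x"] ab by simp
    with p[OF ab'(1)] q[OF ab'(2)] have "a $ x = p" "b $ x = q"
      by linarith+
    with ab' have "a \<in> {a \<in> A. a $ x = p}" "b \<in> {b \<in> B. b $ x = q}"
      by simp_all
    note *[THEN bspec, OF this(1), THEN bspec, OF this(2), rule_format, OF ab'(3)]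
    with \<open>a $ x = p\<close> \<open>b $ x = q\<close> ab ab'(4) show "a $ i = \<alpha> $ i \<and> b $ i = \<beta> $ i"
      by (cases "i = x") simp_all
  qed
qed

instance mfps :: (idom, finite) idom
proof
  fix f g :: "('a, 'b) mfps"
  assume "f \<noteq> 0" "g \<noteq> 0"
  then have "{\<alpha>. mfps_nth f \<alpha> \<noteq> 0} \<noteq> {}" "{\<alpha>. mfps_nth g \<alpha> \<noteq> 0} \<noteq> {}"
    by (auto intro!: mfps_eqI simp: zero_mfps.rep_eq)
  from exists_extremal_pair[OF finite_class.finite_UNIV this]
  obtain \<alpha> \<beta> where ab: "\<alpha> \<in> {\<alpha>. mfps_nth f \<alpha> \<noteq> 0}" "\<beta> \<in> {\<alpha>. mfps_nth g \<alpha> \<noteq> 0}"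
    and ext: "\<forall>a\<in>{\<alpha>. mfps_nth f \<alpha> \<noteq> 0}. \<forall>b\<in>{\<alpha>. mfps_nth g \<alpha> \<noteq> 0}.
      a + b = \<alpha> + \<beta> \<longrightarrow> (\<forall>i\<in>UNIV. a $ i = \<alpha> $ i \<and> b $ i = \<beta> $ i)"
    by (elim bexE)
  have *: "a = \<alpha> \<and> b = \<beta>"
    if "mfps_nth f a \<noteq> 0" "mfps_nth g b \<noteq> 0" "a + b = \<alpha> + \<beta>" for a b
    using ext[rule_format, of a b] that by (simp add: vec_eq_iff[of a \<alpha>] vec_eq_iff[of b \<beta>])
  have "mfps_nth (f * g) (\<alpha> + \<beta>) = (\<Sum>(\<beta>, \<gamma>)\<in>{(\<alpha>, \<beta>)}. mfps_nth f \<beta> * mfps_nth g \<gamma>)"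
    unfolding mfps_nth_mult using *
    by (intro sum.mono_neutral_right, simp, simp add: splits_def) (force simp: splits_def)
  then show "f * g \<noteq> 0"
    using ab by (auto simp: zero_mfps.rep_eq)
qed

lift_definition mfps_deriv :: "'v::finite \<Rightarrow> ('a::comm_ring_1, 'v) mfps \<Rightarrow> ('a, 'v) mfps"
  is "\<lambda>i f \<alpha>. of_nat (\<alpha> $ i + 1) * f (\<alpha> + axis i 1)" .

lemma mfps_deriv_add: "mfps_deriv i (f + g) = mfps_deriv i f + mfps_deriv i g"
  by transfer (simp add: fun_eq_iff algebra_simps)

lemma mfps_deriv_mult: "mfps_deriv i (f * g) = mfps_deriv i f * g + f * mfps_deriv i g"
proof (transfer, rule ext)
  fix i :: 'b and f g :: "nat ^ 'b \<Rightarrow> 'a" and \<alpha> :: "nat ^ 'b"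
  let ?e = "axis i 1 :: nat ^ 'b"
  let ?S = "splits (\<alpha> + ?e)"
  let ?L = "\<lambda>(\<beta>, \<gamma>). of_nat (\<beta> $ i) * f \<beta> * g \<gamma>"
  let ?R = "\<lambda>(\<beta>, \<gamma>). of_nat (\<gamma> $ i) * f \<beta> * g \<gamma>"
  have pos: "\<beta> = (\<beta> - ?e) + ?e" if "0 < \<beta> $ i" for \<beta> :: "nat ^ 'b"
    using that by (auto simp: vec_eq_iff axis_def)
  have inj: "inj (\<lambda>(\<beta>, \<gamma>). (\<beta> + ?e, \<gamma>))" "inj (\<lambda>(\<beta>, \<gamma>). (\<beta>, \<gamma> + ?e))"
    by (auto simp: inj_on_def)
  have dL: "sum ?L ?S = sum ?L ((\<lambda>(\<beta>, \<gamma>). (\<beta> + ?e, \<gamma>)) ` splits \<alpha>)"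
  proof (rule sum.mono_neutral_right)
    show "(\<lambda>(\<beta>, \<gamma>). (\<beta> + ?e, \<gamma>)) ` splits \<alpha> \<subseteq> ?S"
      by (auto simp: splits_def algebra_simps)
    show "\<forall>x\<in>?S - (\<lambda>(\<beta>, \<gamma>). (\<beta> + ?e, \<gamma>)) ` splits \<alpha>. ?L x = 0"
    proof (rule ballI, rule ccontr)
      fix x assume x: "x \<in> ?S - (\<lambda>(\<beta>, \<gamma>). (\<beta> + ?e, \<gamma>)) ` splits \<alpha>" "?L x \<noteq> 0"
      obtain b c where xbc: "x = (b, c)" by (cases x)
      have "0 < b $ i" using x(2) xbc by (cases "b $ i = 0") auto
      note be = pos[OF this]
      have "b + c = \<alpha> + ?e" using x(1) xbc by (auto simp: splits_def)
      then have "((b - ?e) + c) + ?e = \<alpha> + ?e"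
        using be by (metis add.assoc add.commute)
      then have "(b - ?e, c) \<in> splits \<alpha>" by (auto simp: splits_def)
      then have "(b - ?e + ?e, c) \<in> (\<lambda>(\<beta>, \<gamma>). (\<beta> + ?e, \<gamma>)) ` splits \<alpha>"
        by (rule rev_image_eqI) simp
      then show False using x(1) xbc be by simp
    qed
  qed simp
  have dR: "sum ?R ?S = sum ?R ((\<lambda>(\<beta>, \<gamma>). (\<beta>, \<gamma> + ?e)) ` splits \<alpha>)"
  proof (rule sum.mono_neutral_right)
    show "(\<lambda>(\<beta>, \<gamma>). (\<beta>, \<gamma> + ?e)) ` splits \<alpha> \<subseteq> ?S"
      by (auto simp: splits_def algebra_simps)
    show "\<forall>x\<in>?S - (\<lambda>(\<beta>, \<gamma>). (\<beta>, \<gamma> + ?e)) ` splits \<alpha>. ?R x = 0"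
    proof (rule ballI, rule ccontr)
      fix x assume x: "x \<in> ?S - (\<lambda>(\<beta>, \<gamma>). (\<beta>, \<gamma> + ?e)) ` splits \<alpha>" "?R x \<noteq> 0"
      obtain b c where xbc: "x = (b, c)" by (cases x)
      have "0 < c $ i" using x(2) xbc by (cases "c $ i = 0") auto
      note ce = pos[OF this]
      have "b + c = \<alpha> + ?e" using x(1) xbc by (auto simp: splits_def)
      then have "(b + (c - ?e)) + ?e = \<alpha> + ?e"
        using ce by (metis add.assoc)
      then have "(b, c - ?e) \<in> splits \<alpha>" by (auto simp: splits_def)
      then have "(b, c - ?e + ?e) \<in> (\<lambda>(\<beta>, \<gamma>). (\<beta>, \<gamma> + ?e)) ` splits \<alpha>"
        by (rule rev_image_eqI) simp
      then show False using x(1) xbc ce by simp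
    qed
  qed simp
  have "of_nat (\<alpha> $ i + 1) * (\<Sum>(\<beta>, \<gamma>)\<in>?S. f \<beta> * g \<gamma>) =
      (\<Sum>x\<in>?S. ?L x + ?R x)"
    unfolding sum_distrib_left
  proof (rule sum.cong[OF refl])
    fix x assume "x \<in> ?S"
    then obtain b c where x: "x = (b, c)" "b + c = \<alpha> + ?e" by (auto simp: splits_def)
    have "b $ i + c $ i = \<alpha> $ i + 1"
      using arg_cong[OF x(2), of "\<lambda>v. v $ i"] by simp
    then have "of_nat (\<alpha> $ i + 1) = (of_nat (b $ i) + of_nat (c $ i) :: 'a)"
      by (metis of_nat_add)
    then show "of_nat (\<alpha> $ i + 1) * (case x of (\<beta>, \<gamma>) \<Rightarrow> f \<beta> * g \<gamma>) = ?L x + ?R x"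
      by (simp add: x(1) algebra_simps)
  qed
  also have "\<dots> = sum ?L ?S + sum ?R ?S"
    by (rule sum.distrib)
  also have "\<dots> = (\<Sum>(\<beta>, \<gamma>)\<in>splits \<alpha>. of_nat (\<beta> $ i + 1) * f (\<beta> + ?e) * g \<gamma>) +
      (\<Sum>(\<beta>, \<gamma>)\<in>splits \<alpha>. f \<beta> * (of_nat (\<gamma> $ i + 1) * g (\<gamma> + ?e)))"
  proof (rule arg_cong2[of _ _ _ _ "(+)"])
    have "sum ?L ?S = sum (?L \<circ> (\<lambda>(\<beta>, \<gamma>). (\<beta> + ?e, \<gamma>))) (splits \<alpha>)"
      unfolding dL by (rule sum.reindex[OF inj_on_subset[OF inj(1)]]) simp
    then show "sum ?L ?S = (\<Sum>(\<beta>, \<gamma>)\<in>splits \<alpha>. of_nat (\<beta> $ i + 1) * f (\<beta> + ?e) * g \<gamma>)"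
      by (simp add: comp_def case_prod_unfold)
    have "sum ?R ?S = sum (?R \<circ> (\<lambda>(\<beta>, \<gamma>). (\<beta>, \<gamma> + ?e))) (splits \<alpha>)"
      unfolding dR by (rule sum.reindex[OF inj_on_subset[OF inj(2)]]) simp
    then show "sum ?R ?S = (\<Sum>(\<beta>, \<gamma>)\<in>splits \<alpha>. f \<beta> * (of_nat (\<gamma> $ i + 1) * g (\<gamma> + ?e)))"
      by (simp add: comp_def case_prod_unfold algebra_simps)
  qed
  finally show "of_nat (\<alpha> $ i + 1) * (\<Sum>(\<beta>, \<gamma>)\<in>?S. f \<beta> * g \<gamma>) = \<dots>" .
qed

lemma mfps_deriv_commute: "mfps_deriv i (mfps_deriv j f) = mfps_deriv j (mfps_deriv i f)"
proof (cases "i = j")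
  case False
  then show ?thesis
    by transfer (simp add: fun_eq_iff axis_def algebra_simps)
qed simp

section \<open>Partial derivatives on the fraction field\<close>

definition fract_deriv ::
    "'v::finite \<Rightarrow> ('a::idom, 'v) mfps fract \<Rightarrow> ('a, 'v) mfps fract"
  where "fract_deriv i x =
    (case SOME q. snd q \<noteq> 0 \<and> x = Fract (fst q) (snd q) of
      (a, b) \<Rightarrow> Fract (mfps_deriv i a * b - a * mfps_deriv i b) (b * b))"

text \<open>The quotient rule does not depend on the chosen representative.\<close>

lemma fract_deriv_Fract:
  assumes "b \<noteq> 0"
  shows "fract_deriv i (Fract a b) = Fract (mfps_deriv i a * b - a * mfps_deriv i b) (b * b)"
proof -
  define q where "q = (SOME q. snd q \<noteq> 0 \<and> Fract a b = Fract (fst q) (snd q))"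
  obtain c d where q: "q = (c, d)" by (cases q)
  have "\<exists>q. snd q \<noteq> 0 \<and> Fract a b = Fract (fst q) (snd q)"
    using assms by (intro exI[of _ "(a, b)"]) simp
  from someI_ex[OF this] have "snd q \<noteq> 0 \<and> Fract a b = Fract (fst q) (snd q)"
    unfolding q_def .
  then have nz: "d \<noteq> 0" and "Fract a b = Fract c d"
    by (simp_all add: q)
  then have eq: "a * d = c * b"
    using Fraction_Field.eq_fract(1)[OF assms nz] by blast
  let ?D = "mfps_deriv i"
  have "?D a * d + a * ?D d = ?D c * b + c * ?D b"
    using arg_cong[OF eq, of ?D] by (simp add: mfps_deriv_mult)
  then have key: "?D a * d - c * ?D b = ?D c * b - a * ?D d"
    by (simp add: algebra_simps)
  have "(?D c * d - c * ?D d) * (b * b) = (?D c * b) * (b * d) - (c * b) * (?D d * b)"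
    by (simp add: algebra_simps)
  also have "\<dots> = (?D c * b) * (b * d) - (a * d) * (?D d * b)"
    by (simp only: eq)
  also have "\<dots> = (?D c * b - a * ?D d) * (b * d)"
    by (simp add: algebra_simps)
  also have "\<dots> = (?D a * d - c * ?D b) * (b * d)"
    by (simp only: key)
  also have "\<dots> = (?D a * d) * (b * d) - (c * b) * (?D b * d)"
    by (simp add: algebra_simps)
  also have "\<dots> = (?D a * d) * (b * d) - (a * d) * (?D b * d)"
    by (simp only: eq)
  also have "\<dots> = (?D a * b - a * ?D b) * (d * d)"
    by (simp add: algebra_simps)
  finally have "(?D c * d - c * ?D d) * (b * b) = (?D a * b - a * ?D b) * (d * d)" .
  with nz assms show ?thesis
    unfolding fract_deriv_def by (simp add: eq_fract q flip: q_def)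
qed

lemma fract_deriv_add: "fract_deriv i (x + y) = fract_deriv i x + fract_deriv i y"
  by (cases x, cases y)
    (simp add: fract_deriv_Fract mfps_deriv_add mfps_deriv_mult eq_fract, simp add: algebra_simps)

lemma fract_deriv_mult: "fract_deriv i (x * y) = fract_deriv i x * y + x * fract_deriv i y"
  by (cases x, cases y)
    (simp add: fract_deriv_Fract mfps_deriv_add mfps_deriv_mult eq_fract, simp add: algebra_simps)

lemma fract_deriv_Fract_1: "fract_deriv i (Fract a 1) = Fract (mfps_deriv i a) 1"
proof -
  have "mfps_deriv i (1 * 1 :: ('a, 'b) mfps) = mfps_deriv i 1 * 1 + 1 * mfps_deriv i 1"
    by (rule mfps_deriv_mult)
  then have "mfps_deriv i (1 :: ('a, 'b) mfps) = 0"
    by (simp only: mult_1 mult_1_right add_cancel_right_right)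
  then show ?thesis by (simp add: fract_deriv_Fract)
qed

lemma fract_deriv_0 [simp]: "fract_deriv i 0 = 0"
  using fract_deriv_add[of i 0 0] by (simp only: add_0_left add_cancel_right_right)

lemma fract_deriv_sum: "fract_deriv i (sum f A) = (\<Sum>x\<in>A. fract_deriv i (f x))"
  by (induction A rule: infinite_finite_induct) (simp_all add: fract_deriv_add)

lemma fract_deriv_commute: "fract_deriv i (fract_deriv j x) = fract_deriv j (fract_deriv i x)"
proof -
  define c where "c x = fract_deriv i (fract_deriv j x) - fract_deriv j (fract_deriv i x)"
    for x :: "('a, 'b) mfps fract"
  have mult: "c (x * y) = c x * y + x * c y" for x y
    by (simp add: c_def fract_deriv_mult fract_deriv_add algebra_simps)
  have const: "c (Fract a 1) = 0" for a
    by (simp add: c_def fract_deriv_Fract_1 mfps_deriv_commute[of i j])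
  obtain a b where x: "x = Fract a b" "b \<noteq> 0" by (cases x)
  then have "x * Fract b 1 = Fract a 1" by (simp add: eq_fract)
  with mult[of x "Fract b 1"] const have "c x * Fract b 1 = 0" by simp
  moreover have "Fract b 1 \<noteq> 0" using x by (simp add: Zero_fract_def eq_fract)
  ultimately show ?thesis by (simp add: c_def)
qed

section \<open>Linear differential operators\<close>

text \<open>
  The injection \<open>\<iota> :: 'n \<Rightarrow> 'v\<close> selects the variables \<open>x\<^sub>1, \<dots>, x\<^sub>n\<close> with respect to which one
  differentiates, so \<open>n = CARD('n)\<close> and \<open>n + m = CARD('v)\<close>.
  Multi-indices are elements of \<open>nat ^ 'n\<close>.
\<close>

definition fract_derivs ::
    "('n::finite \<Rightarrow> 'v::finite) \<Rightarrow> nat ^ 'n \<Rightarrow> ('a::idom, 'v) mfps fract \<Rightarrow> ('a, 'v) mfps fract"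
  where "fract_derivs \<iota> \<alpha> = Finite_Set.fold (\<lambda>i f. (fract_deriv (\<iota> i) ^^ (\<alpha> $ i)) \<circ> f) id UNIV"

definition End_ring :: "('a::ab_group_add \<Rightarrow> 'a) ring"
  where "End_ring =
    \<lparr>carrier = {f. Modules.additive f}, monoid.mult = (\<circ>), one = id,
     zero = (\<lambda>_. 0), add = (\<lambda>f g x. f x + g x)\<rparr>"

lemma ring_End_ring: "ring (End_ring :: ('a::ab_group_add \<Rightarrow> 'a) ring)"
proof (rule ringI)
  show "abelian_group (End_ring :: ('a \<Rightarrow> 'a) ring)"
  proof (rule abelian_groupI)
    fix f :: "'a \<Rightarrow> 'a" assume "f \<in> carrier End_ring"
    then show "\<exists>g\<in>carrier End_ring. g \<oplus>\<^bsub>End_ring\<^esub> f = \<zero>\<^bsub>End_ring\<^esub>"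
      by (intro bexI[of _ "\<lambda>x. - f x"]) (auto simp: End_ring_def Modules.additive_def)
  qed (auto simp: End_ring_def Modules.additive_def algebra_simps)
  show "monoid (End_ring :: ('a \<Rightarrow> 'a) ring)"
    by (rule monoidI) (auto simp: End_ring_def Modules.additive_def)
qed (auto simp: End_ring_def Modules.additive_def)

definition subalg_ring ::
    "('k::field_char_0, 'v::finite) mfps fract set \<Rightarrow> ('k, 'v) mfps fract ring"
  where "subalg_ring H = ring_of_type_algebra\<lparr>carrier := H\<rparr>"

text \<open>The ring \<open>\<D> = H[\<partial>]\<close>, realised inside the additive endomorphisms of the fraction field;
  \<open>h \<in> H\<close> acts by multiplication.\<close>

definition diff_ops ::
    "('n::finite \<Rightarrow> 'v::finite) \<Rightarrow> ('k::field_char_0, 'v) mfps fract set \<Rightarrow>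
     (('k, 'v) mfps fract \<Rightarrow> ('k, 'v) mfps fract) ring"
  where "diff_ops \<iota> H =
    End_ring\<lparr>carrier := generate_ring End_ring ((\<lambda>h. (*) h) ` H \<union> range (\<lambda>i. fract_deriv (\<iota> i)))\<rparr>"

text \<open>\<open>P = \<Sum>\<^sub>\<alpha> p\<^sub>\<alpha> \<partial>\<^sup>\<alpha>\<close>, as an identity of operators on the fraction field.\<close>

definition is_expansion ::
    "('n::finite \<Rightarrow> 'v::finite) \<Rightarrow> (('k::field_char_0, 'v) mfps fract \<Rightarrow> ('k, 'v) mfps fract) \<Rightarrow>
     (nat ^ 'n \<Rightarrow> ('k, 'v) mfps fract) \<Rightarrow> bool"
  where "is_expansion \<iota> P p \<longleftrightarrow>
    finite {\<alpha>. p \<alpha> \<noteq> 0} \<and> P = (\<lambda>z. \<Sum>\<alpha> | p \<alpha> \<noteq> 0. p \<alpha> * fract_derivs \<iota> \<alpha> z)"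

definition op_coeff ::
    "('n::finite \<Rightarrow> 'v::finite) \<Rightarrow> (('k::field_char_0, 'v) mfps fract \<Rightarrow> ('k, 'v) mfps fract) \<Rightarrow>
     nat ^ 'n \<Rightarrow> ('k, 'v) mfps fract"
  where "op_coeff \<iota> P = (THE p. is_expansion \<iota> P p)"

lemma fract_deriv_pow_commute1:
  "fract_deriv i ((fract_deriv j ^^ l) x) = (fract_deriv j ^^ l) (fract_deriv i x)"
  by (induction l) (simp_all add: fract_deriv_commute[of i j])

lemma fract_deriv_pow_commute:
  "(fract_deriv i ^^ k) \<circ> (fract_deriv j ^^ l) = (fract_deriv j ^^ l) \<circ> (fract_deriv i ^^ k)"
proof
  fix x
  show "((fract_deriv i ^^ k) \<circ> (fract_deriv j ^^ l)) x = ((fract_deriv j ^^ l) \<circ> (fract_deriv i ^^ k)) x"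
    by (induction k) (simp_all add: fract_deriv_pow_commute1[where i = i and j = j])
qed

context
  fixes \<iota> :: "'n::finite \<Rightarrow> 'v::finite"
begin

lemma comp_fun_commute_fract_derivs:
  fixes \<alpha> :: "nat ^ 'n"
  shows "comp_fun_commute
    (\<lambda>i (f :: ('a::idom, 'v) mfps fract \<Rightarrow> ('a, 'v) mfps fract). (fract_deriv (\<iota> i) ^^ (\<alpha> $ i)) \<circ> f)"
proof
  fix i j :: 'n
  let ?D = "\<lambda>i. fract_deriv (\<iota> i) ^^ (\<alpha> $ i) :: ('a, 'v) mfps fract \<Rightarrow> ('a, 'v) mfps fract"
  have "?D j \<circ> ?D i = ?D i \<circ> ?D j"
    using fract_deriv_pow_commute by blast
  then show "(\<lambda>f. ?D j \<circ> f) \<circ> (\<lambda>f. ?D i \<circ> f) = (\<lambda>f. ?D i \<circ> f) \<circ> (\<lambda>f. ?D j \<circ> f)"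
    by (auto simp: fun_eq_iff)
qed

lemma fold_fract_derivs_insert:
  fixes \<alpha> :: "nat ^ 'n" and S :: "'n set"
    and id' :: "('a::idom, 'v) mfps fract \<Rightarrow> ('a, 'v) mfps fract"
  assumes "finite S" "i \<notin> S"
  shows "Finite_Set.fold (\<lambda>i f. (fract_deriv (\<iota> i) ^^ (\<alpha> $ i)) \<circ> f) id' (insert i S) =
    (fract_deriv (\<iota> i) ^^ (\<alpha> $ i)) \<circ> Finite_Set.fold (\<lambda>i f. (fract_deriv (\<iota> i) ^^ (\<alpha> $ i)) \<circ> f) id' S"
  using comp_fun_commute_on.fold_insert[OF
      comp_fun_commute_fract_derivs[unfolded comp_fun_commute_def'] subset_UNIV assms] .

lemma fract_derivs_0: "fract_derivs \<iota> 0 = id"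
proof -
  have "Finite_Set.fold (\<lambda>i f. (fract_deriv (\<iota> i) ^^ ((0 :: nat ^ 'n) $ i)) \<circ> f) id S = id"
    if "finite S" for S
    using that
  proof (induction S)
    case (insert i S)
    show ?case
      by (subst fold_fract_derivs_insert[OF insert.hyps])
        (simp only: insert.IH, simp add: fun_eq_iff)
  qed simp
  then show ?thesis by (simp add: fract_derivs_def)
qed

lemma fract_deriv_fract_derivs:
  "fract_deriv (\<iota> i) (fract_derivs \<iota> \<alpha> z) = fract_derivs \<iota> (\<alpha> + axis i 1) z"
proof -
  let ?F = "\<lambda>\<alpha> :: nat ^ 'n. \<lambda>j f. (fract_deriv (\<iota> j) ^^ (\<alpha> $ j)) \<circ> f"
  have rec: "Finite_Set.fold (?F \<beta>) id UNIV =
      (fract_deriv (\<iota> i) ^^ (\<beta> $ i)) \<circ> Finite_Set.fold (?F \<beta>) id (UNIV - {i})" for \<beta>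
    using fold_fract_derivs_insert[of "UNIV - {i}" i \<beta> id] by (simp add: insert_absorb)
  have eq: "Finite_Set.fold (?F (\<alpha> + axis i 1)) id (UNIV - {i}) = Finite_Set.fold (?F \<alpha>) id (UNIV - {i})"
    by (rule Finite_Set.fold_closed_eq[where B = UNIV]) (auto simp: axis_def)
  show ?thesis
    unfolding fract_derivs_def rec eq by simp
qed

text \<open>
  On a power series, \<open>\<partial>\<^sup>\<alpha>\<close> shifts the coefficients by \<open>\<alpha>\<close> up to nonzero integer factors.
\<close>

lemma mfps_deriv_pow_nth:
  "\<exists>c. c \<noteq> 0 \<and> mfps_nth ((mfps_deriv i ^^ k) f) \<gamma> = of_nat c * mfps_nth f (\<gamma> + axis i k)"
proof (induction k arbitrary: \<gamma>)
  case 0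
  have axis_0: "axis i (0::nat) = 0" by (simp add: vec_eq_iff axis_def)
  show ?case by (intro exI[of _ 1]) (simp add: axis_0)
next
  case (Suc k)
  obtain c where c: "c \<noteq> 0" "mfps_nth ((mfps_deriv i ^^ k) f) (\<gamma> + axis i 1) =
      of_nat c * mfps_nth f (\<gamma> + axis i 1 + axis i k)"
    using Suc by blast
  have "\<gamma> + axis i 1 + axis i k = \<gamma> + axis i (Suc k)"
    by (simp add: vec_eq_iff axis_def)
  with c show ?case
    by (intro exI[of _ "(\<gamma> $ i + 1) * c"]) (simp add: mfps_deriv.rep_eq algebra_simps)
qed

lemma fract_deriv_pow_Fract_1: "(fract_deriv i ^^ k) (Fract f 1) = Fract ((mfps_deriv i ^^ k) f) 1"
  by (induction k) (simp_all add: fract_deriv_Fract_1)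

definition embed_index :: "nat ^ 'n \<Rightarrow> nat ^ 'v"
  where "embed_index \<alpha> = (\<Sum>i\<in>UNIV. axis (\<iota> i) (\<alpha> $ i))"

lemma fract_derivs_Fract_1:
  "\<exists>g. fract_derivs \<iota> \<alpha> (Fract f 1) = Fract g 1 \<and>
    (\<forall>\<gamma>. \<exists>c. c \<noteq> 0 \<and> mfps_nth g \<gamma> = of_nat c * mfps_nth f (\<gamma> + embed_index \<alpha>))"
proof -
  let ?F = "\<lambda>i f. (fract_deriv (\<iota> i) ^^ (\<alpha> $ i)) \<circ> f"
  have "\<exists>g. Finite_Set.fold ?F id S (Fract f 1) = Fract g 1 \<and>
      (\<forall>\<gamma>. \<exists>c. c \<noteq> 0 \<and> mfps_nth g \<gamma> = of_nat c * mfps_nth f (\<gamma> + (\<Sum>i\<in>S. axis (\<iota> i) (\<alpha> $ i))))"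
    if "finite S" for S
    using that
  proof (induction S)
    case empty
    then show ?case by (intro exI[of _ f] conjI allI exI[of _ 1]) simp_all
  next
    case (insert i S)
    then obtain g where g: "Finite_Set.fold ?F id S (Fract f 1) = Fract g 1"
      "\<And>\<gamma>. \<exists>c. c \<noteq> 0 \<and> mfps_nth g \<gamma> = of_nat c * mfps_nth f (\<gamma> + (\<Sum>i\<in>S. axis (\<iota> i) (\<alpha> $ i)))"
      by blast
    have "\<exists>c. c \<noteq> 0 \<and> mfps_nth ((mfps_deriv (\<iota> i) ^^ (\<alpha> $ i)) g) \<gamma> =
        of_nat c * mfps_nth f (\<gamma> + (\<Sum>i\<in>insert i S. axis (\<iota> i) (\<alpha> $ i)))" for \<gamma>
    proof -
      obtain c where c: "c \<noteq> 0" "mfps_nth ((mfps_deriv (\<iota> i) ^^ (\<alpha> $ i)) g) \<gamma> =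
          of_nat c * mfps_nth g (\<gamma> + axis (\<iota> i) (\<alpha> $ i))"
        using mfps_deriv_pow_nth by blast
      obtain d where d: "d \<noteq> 0" "mfps_nth g (\<gamma> + axis (\<iota> i) (\<alpha> $ i)) =
          of_nat d * mfps_nth f (\<gamma> + axis (\<iota> i) (\<alpha> $ i) + (\<Sum>i\<in>S. axis (\<iota> i) (\<alpha> $ i)))"
        using g(2) by blast
      show ?thesis
        using c d insert.hyps by (intro exI[of _ "c * d"]) (simp add: algebra_simps)
    qed
    moreover have "Finite_Set.fold ?F id (insert i S) (Fract f 1) = Fract ((mfps_deriv (\<iota> i) ^^ (\<alpha> $ i)) g) 1"
      using g(1) insert.hyps
      by (simp add: fold_fract_derivs_insert fract_deriv_pow_Fract_1)
    ultimately show ?case by blast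
  qed
  then show ?thesis by (simp add: fract_derivs_def embed_index_def)
qed

lemma embed_index_nth: "inj \<iota> \<Longrightarrow> embed_index \<alpha> $ \<iota> i = \<alpha> $ i"
  by (simp add: embed_index_def axis_def inj_eq sum.delta)

lemma expansion_eq_zero:
  fixes p :: "nat ^ 'n \<Rightarrow> ('k::field_char_0, 'v) mfps fract"
  assumes inj: "inj \<iota>" and fin: "finite A"
    and zero: "\<And>z. (\<Sum>\<alpha>\<in>A. p \<alpha> * fract_derivs \<iota> \<alpha> z) = 0"
  shows "\<alpha> \<in> A \<Longrightarrow> p \<alpha> = 0"
proof (rule ccontr)
  assume "\<alpha> \<in> A" "p \<alpha> \<noteq> 0"
  define B where "B = {\<alpha> \<in> A. p \<alpha> \<noteq> 0}"
  define size where "size \<alpha> = (\<Sum>i\<in>UNIV. \<alpha> $ i)" for \<alpha> :: "nat ^ 'n"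
  have "B \<noteq> {}" "finite B" using \<open>\<alpha> \<in> A\<close> \<open>p \<alpha> \<noteq> 0\<close> fin by (auto simp: B_def)
  then obtain b where b: "b \<in> B" "\<And>a. a \<in> B \<Longrightarrow> size b \<le> size a"
    by (metis arg_min_if_finite(1) arg_min_least)
  define f :: "('k, 'v) mfps" where "f = Abs_mfps (\<lambda>\<gamma>. if \<gamma> = embed_index b then 1 else 0)"
  have f: "mfps_nth f \<gamma> = (if \<gamma> = embed_index b then 1 else 0)" for \<gamma>
    by (simp add: f_def Abs_mfps_inverse)
  have vanish: "fract_derivs \<iota> a (Fract f 1) = 0" if "a \<in> B" "a \<noteq> b" for a
  proof -
    obtain g where g: "fract_derivs \<iota> a (Fract f 1) = Fract g 1"
      "\<And>\<gamma>. \<exists>c. c \<noteq> 0 \<and> mfps_nth g \<gamma> = of_nat c * mfps_nth f (\<gamma> + embed_index a)"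
      using fract_derivs_Fract_1 by blast
    have "\<gamma> + embed_index a \<noteq> embed_index b" for \<gamma>
    proof
      assume *: "\<gamma> + embed_index a = embed_index b"
      have le: "a $ i \<le> b $ i" for i
        using arg_cong[OF *, of "\<lambda>v. v $ \<iota> i"] by (simp add: embed_index_nth[OF inj])
      from that(2) obtain j where "a $ j \<noteq> b $ j" by (auto simp: vec_eq_iff)
      with le[of j] have "a $ j < b $ j" by simp
      then have "size a < size b"
        unfolding size_def using le by (intro sum_strict_mono_ex1) auto
      with b(2)[OF that(1)] show False by simp
    qed
    with g(2) f have "mfps_nth g \<gamma> = 0" for \<gamma> by (metis mult_zero_right)
    then have "g = 0" by (intro mfps_eqI) (simp add: zero_mfps.rep_eq)
    with g(1) show ?thesis by (simp add: Zero_fract_def)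
  qed
  have "(\<Sum>\<alpha>\<in>A. p \<alpha> * fract_derivs \<iota> \<alpha> (Fract f 1)) = (\<Sum>\<alpha>\<in>{b}. p \<alpha> * fract_derivs \<iota> \<alpha> (Fract f 1))"
    using b(1) vanish fin by (intro sum.mono_neutral_right) (auto simp: B_def)
  with zero b(1) have "fract_derivs \<iota> b (Fract f 1) = 0" by (simp add: B_def)
  moreover obtain g where g: "fract_derivs \<iota> b (Fract f 1) = Fract g 1"
      "\<And>\<gamma>. \<exists>c. c \<noteq> 0 \<and> mfps_nth g \<gamma> = of_nat c * mfps_nth f (\<gamma> + embed_index b)"
    using fract_derivs_Fract_1 by blast
  ultimately have "g = 0" by (simp add: Zero_fract_def eq_fract)
  with g(2)[of 0] f[of "embed_index b"] show False by (auto simp: zero_mfps.rep_eq)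
qed

lemma is_expansion_unique:
  assumes "inj \<iota>" "is_expansion \<iota> P p" "is_expansion \<iota> P q"
  shows "p = q"
proof
  fix \<alpha>
  define A where "A = {\<alpha>. p \<alpha> \<noteq> 0} \<union> {\<alpha>. q \<alpha> \<noteq> 0}"
  have A: "finite A" using assms by (simp add: A_def is_expansion_def)
  have "(\<Sum>\<alpha>\<in>A. (p \<alpha> - q \<alpha>) * fract_derivs \<iota> \<alpha> z) = 0" for z
  proof -
    have "(\<Sum>\<alpha>\<in>A. p \<alpha> * fract_derivs \<iota> \<alpha> z) = P z"
      using assms(2) A unfolding is_expansion_def
      by (simp, intro sum.mono_neutral_right) (auto simp: A_def)
    moreover have "(\<Sum>\<alpha>\<in>A. q \<alpha> * fract_derivs \<iota> \<alpha> z) = P z"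
      using assms(3) A unfolding is_expansion_def
      by (simp, intro sum.mono_neutral_right) (auto simp: A_def)
    ultimately show ?thesis by (simp add: left_diff_distrib sum_subtractf)
  qed
  from expansion_eq_zero[OF assms(1) A this, of \<alpha>] show "p \<alpha> = q \<alpha>"
    by (cases "\<alpha> \<in> A") (auto simp: A_def)
qed

lemma op_coeff_eqI: "inj \<iota> \<Longrightarrow> is_expansion \<iota> P p \<Longrightarrow> op_coeff \<iota> P = p"
  unfolding op_coeff_def by (rule the_equality) (auto intro: is_expansion_unique)

lemma diff_ops_expansion:
  fixes H :: "('k::field_char_0, 'v) mfps fract set"
  assumes H: "subring H ring_of_type_algebra"
    and stable: "\<And>i h. h \<in> H \<Longrightarrow> fract_deriv (\<iota> i) h \<in> H"
    and P: "P \<in> carrier (diff_ops \<iota> H)"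
  shows "\<exists>p. is_expansion \<iota> P p \<and> range p \<subseteq> H"
proof -
  define F where "F = {P. \<exists>p. is_expansion \<iota> P p \<and> range p \<subseteq> H}"
  have H0: "0 \<in> H" and H1: "1 \<in> H" and Hadd: "\<And>a b. a \<in> H \<Longrightarrow> b \<in> H \<Longrightarrow> a + b \<in> H"
    and Hmult: "\<And>a b. a \<in> H \<Longrightarrow> b \<in> H \<Longrightarrow> a * b \<in> H"
    using subringE[OF H] by (simp_all add: ring_of_type_algebra_def)
  have Hneg: "- h \<in> H" if "h \<in> H" for h
  proof -
    interpret T: ring "ring_of_type_algebra :: ('k, 'v) mfps fract ring"
      by (rule ring_from_type_algebra)
    have "\<ominus>\<^bsub>ring_of_type_algebra\<^esub> h = - h"
      by (rule T.minus_equality) (simp_all add: ring_of_type_algebra_def)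
    with subringE(5)[OF H that] show ?thesis by simp
  qed
  have FI: "(\<lambda>z. \<Sum>\<alpha>\<in>A. p \<alpha> * fract_derivs \<iota> \<alpha> z) \<in> F"
    if "finite A" "\<And>\<alpha>. \<alpha> \<in> A \<Longrightarrow> p \<alpha> \<in> H" for A p
  proof -
    define q where "q \<alpha> = (if \<alpha> \<in> A then p \<alpha> else 0)" for \<alpha>
    have "finite {\<alpha>. q \<alpha> \<noteq> 0}"
      by (rule finite_subset[OF _ that(1)]) (auto simp: q_def)
    moreover have "(\<Sum>\<alpha>\<in>A. p \<alpha> * fract_derivs \<iota> \<alpha> z) = (\<Sum>\<alpha> | q \<alpha> \<noteq> 0. q \<alpha> * fract_derivs \<iota> \<alpha> z)" for z
      using that(1) by (intro sum.mono_neutral_cong_right) (auto simp: q_def)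
    ultimately have "is_expansion \<iota> (\<lambda>z. \<Sum>\<alpha>\<in>A. p \<alpha> * fract_derivs \<iota> \<alpha> z) q"
      by (simp add: is_expansion_def)
    moreover have "range q \<subseteq> H" using that(2) H0 by (auto simp: q_def)
    ultimately show ?thesis by (auto simp: F_def)
  qed
  have FE: "\<exists>A p. finite A \<and> range p \<subseteq> H \<and> P = (\<lambda>z. \<Sum>\<alpha>\<in>A. p \<alpha> * fract_derivs \<iota> \<alpha> z)"
    if "P \<in> F" for P
    using that unfolding F_def is_expansion_def by blast
  have single: "(\<lambda>z. h * fract_derivs \<iota> \<alpha> z) \<in> F" if "h \<in> H" for h \<alpha>
    using FI[of "{\<alpha>}" "\<lambda>_. h"] that by simp
  have add: "(\<lambda>z. P z + Q z) \<in> F" if "P \<in> F" "Q \<in> F" for P Q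
  proof -
    obtain A p where A: "finite A" "range p \<subseteq> H" "P = (\<lambda>z. \<Sum>\<alpha>\<in>A. p \<alpha> * fract_derivs \<iota> \<alpha> z)"
      using FE \<open>P \<in> F\<close> by blast
    obtain B q where B: "finite B" "range q \<subseteq> H" "Q = (\<lambda>z. \<Sum>\<alpha>\<in>B. q \<alpha> * fract_derivs \<iota> \<alpha> z)"
      using FE \<open>Q \<in> F\<close> by blast
    define r where "r \<alpha> = (if \<alpha> \<in> A then p \<alpha> else 0) + (if \<alpha> \<in> B then q \<alpha> else 0)" for \<alpha>
    have "P z + Q z = (\<Sum>\<alpha>\<in>A \<union> B. r \<alpha> * fract_derivs \<iota> \<alpha> z)" for z
    proof -
      have "P z = (\<Sum>\<alpha>\<in>A \<union> B. (if \<alpha> \<in> A then p \<alpha> else 0) * fract_derivs \<iota> \<alpha> z)"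
        unfolding A(3) using A(1) B(1) by (intro sum.mono_neutral_cong_left) auto
      moreover have "Q z = (\<Sum>\<alpha>\<in>A \<union> B. (if \<alpha> \<in> B then q \<alpha> else 0) * fract_derivs \<iota> \<alpha> z)"
        unfolding B(3) using A(1) B(1) by (intro sum.mono_neutral_cong_left) auto
      ultimately show ?thesis by (simp add: r_def ring_distribs sum.distrib)
    qed
    moreover have "r \<alpha> \<in> H" for \<alpha> using A(2) B(2) H0 Hadd by (auto simp: r_def)
    ultimately show ?thesis using FI[of "A \<union> B" r] A(1) B(1) by simp
  qed
  have sums: "(\<lambda>z. \<Sum>a\<in>A. f a z) \<in> F" if "finite A" "\<And>a. a \<in> A \<Longrightarrow> f a \<in> F"
    for A :: "(nat ^ 'n) set" and f
    using that
  proof (induction A)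
    case empty
    show ?case using single[OF H0, of 0] by simp
  next
    case (insert a A)
    then show ?case using add[of "f a" "\<lambda>z. \<Sum>a\<in>A. f a z"] by simp
  qed
  have scale: "(\<lambda>z. h * P z) \<in> F" if "h \<in> H" "P \<in> F" for h P
  proof -
    obtain A p where A: "finite A" "range p \<subseteq> H" "P = (\<lambda>z. \<Sum>\<alpha>\<in>A. p \<alpha> * fract_derivs \<iota> \<alpha> z)"
      using FE \<open>P \<in> F\<close> by blast
    have "(\<lambda>z. h * P z) = (\<lambda>z. \<Sum>\<alpha>\<in>A. (h * p \<alpha>) * fract_derivs \<iota> \<alpha> z)"
      by (simp add: A(3) sum_distrib_left mult.assoc)
    then show ?thesis using FI[of A "\<lambda>\<alpha>. h * p \<alpha>"] A(1,2) Hmult that(1) by auto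
  qed
  have deriv: "(\<lambda>z. fract_deriv (\<iota> i) (P z)) \<in> F" if "P \<in> F" for i P
  proof -
    obtain A p where A: "finite A" "range p \<subseteq> H" "P = (\<lambda>z. \<Sum>\<alpha>\<in>A. p \<alpha> * fract_derivs \<iota> \<alpha> z)"
      using FE \<open>P \<in> F\<close> by blast
    have "(\<lambda>z. fract_deriv (\<iota> i) (P z)) = (\<lambda>z. \<Sum>\<alpha>\<in>A. fract_deriv (\<iota> i) (p \<alpha>) * fract_derivs \<iota> \<alpha> z +
        p \<alpha> * fract_derivs \<iota> (\<alpha> + axis i 1) z)"
      by (simp add: A(3) fract_deriv_sum fract_deriv_mult fract_deriv_fract_derivs)
    moreover have "\<dots> \<in> F"
      using A(1,2) stable by (intro sums add single) auto
    ultimately show ?thesis by simp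
  qed
  have pow: "(\<lambda>z. (fract_deriv (\<iota> i) ^^ k) (P z)) \<in> F" if "P \<in> F" for i k P
  proof (induction k)
    case 0
    then show ?case using that by simp
  next
    case (Suc k)
    then show ?case using deriv[OF Suc, of i] by simp
  qed
  have derivs: "(\<lambda>z. fract_derivs \<iota> \<alpha> (P z)) \<in> F" if "P \<in> F" for \<alpha> P
  proof -
    let ?F = "\<lambda>i f. (fract_deriv (\<iota> i) ^^ (\<alpha> $ i)) \<circ> f"
    have "(\<lambda>z. Finite_Set.fold ?F id S (P z)) \<in> F" if "finite S" for S
      using that
    proof (induction S)
      case empty
      show ?case using \<open>P \<in> F\<close> by simp
    next
      case (insert i S)
      show ?case
        by (subst fold_fract_derivs_insert[OF insert.hyps], subst comp_apply)
          (rule pow[OF insert.IH])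
    qed
    from this[of UNIV] show ?thesis by (simp add: fract_derivs_def)
  qed
  have comp: "Q \<circ> P \<in> F" if "Q \<in> F" "P \<in> F" for Q P
  proof -
    obtain A q where A: "finite A" "range q \<subseteq> H" "Q = (\<lambda>z. \<Sum>\<alpha>\<in>A. q \<alpha> * fract_derivs \<iota> \<alpha> z)"
      using FE \<open>Q \<in> F\<close> by blast
    have "(\<lambda>z. \<Sum>\<alpha>\<in>A. q \<alpha> * fract_derivs \<iota> \<alpha> (P z)) \<in> F"
      using A(1,2) that(2) by (intro sums scale derivs) auto
    then show ?thesis by (simp add: A(3) comp_def)
  qed
  interpret E: ring "End_ring :: (('k, 'v) mfps fract \<Rightarrow> ('k, 'v) mfps fract) ring"
    by (rule ring_End_ring)
  let ?G = "(\<lambda>h. (*) h) ` H \<union> range (\<lambda>i. fract_deriv (\<iota> i))"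
  have G: "?G \<subseteq> carrier End_ring"
    by (auto simp: End_ring_def Modules.additive_def fract_deriv_add ring_distribs)
  have "P \<in> generate_ring End_ring ?G"
    using P by (simp add: diff_ops_def)
  then have "P \<in> F"
  proof induction
    case one
    show ?case using single[OF H1, of 0] by (simp add: End_ring_def fract_derivs_0 id_def)
  next
    case (incl P)
    have "(\<lambda>z. 1 * fract_derivs \<iota> 0 z) \<in> F" by (rule single[OF H1])
    then have "(\<lambda>z. z) \<in> F" by (simp add: fract_derivs_0)
    with incl scale deriv show ?case by fastforce
  next
    case (a_inv P)
    have "P \<in> carrier End_ring" using E.generate_ring_in_carrier[OF G a_inv.hyps] .
    then have "\<ominus>\<^bsub>End_ring\<^esub> P = (\<lambda>z. - P z)"
      by (intro E.minus_equality) (auto simp: End_ring_def Modules.additive_def)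
    with scale[OF Hneg[OF H1] a_inv.IH] show ?case by simp
  next
    case (eng_add P Q)
    then show ?case using add[of P Q] by (simp add: End_ring_def)
  next
    case (eng_mult P Q)
    then show ?case using comp[of P Q] by (simp add: End_ring_def comp_def)
  qed
  then show ?thesis by (simp add: F_def)
qed

end

locale monomial_order = wellorder "lt\<^sup>=\<^sup>=" lt
  for lt :: "nat ^ 'n::finite \<Rightarrow> nat ^ 'n \<Rightarrow> bool" +
  assumes add_less_iff: "lt (\<alpha> + \<gamma>) (\<beta> + \<gamma>) \<longleftrightarrow> lt \<alpha> \<beta>"

definition op_exp ::
    "(nat ^ 'n::finite \<Rightarrow> nat ^ 'n \<Rightarrow> bool) \<Rightarrow> ('n \<Rightarrow> 'v::finite) \<Rightarrow>
     (('k::field_char_0, 'v) mfps fract \<Rightarrow> ('k, 'v) mfps fract) \<Rightarrow> nat ^ 'n"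
  where "op_exp lt \<iota> P = linorder.Max lt\<^sup>=\<^sup>= {\<alpha>. op_coeff \<iota> P \<alpha> \<noteq> 0}"

definition op_lead_coeff ::
    "(nat ^ 'n::finite \<Rightarrow> nat ^ 'n \<Rightarrow> bool) \<Rightarrow> ('n \<Rightarrow> 'v::finite) \<Rightarrow>
     (('k::field_char_0, 'v) mfps fract \<Rightarrow> ('k, 'v) mfps fract) \<Rightarrow> ('k, 'v) mfps fract"
  where "op_lead_coeff lt \<iota> P = op_coeff \<iota> P (op_exp lt \<iota> P)"

lemma op_exp_greatest:
  assumes "monomial_order lt" "finite {\<alpha>. op_coeff \<iota> P \<alpha> \<noteq> 0}" "op_coeff \<iota> P \<alpha> \<noteq> 0"
  shows "op_lead_coeff lt \<iota> P \<noteq> 0" "\<alpha> = op_exp lt \<iota> P \<or> lt \<alpha> (op_exp lt \<iota> P)"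
proof -
  interpret monomial_order lt by fact
  have "op_exp lt \<iota> P \<in> {\<alpha>. op_coeff \<iota> P \<alpha> \<noteq> 0}"
    unfolding op_exp_def by (rule Max_in) (use assms in auto)
  then show "op_lead_coeff lt \<iota> P \<noteq> 0" by (simp add: op_lead_coeff_def)
  have "lt\<^sup>=\<^sup>= \<alpha> (op_exp lt \<iota> P)"
    unfolding op_exp_def by (rule Max_ge) (use assms in auto)
  then show "\<alpha> = op_exp lt \<iota> P \<or> lt \<alpha> (op_exp lt \<iota> P)" by auto
qed

text \<open>The one-sided version of the library's \<open>ideal\<close>.\<close>

locale left_ideal = additive_subgroup I R + ring R for I and R (structure) +
  assumes I_l_closed: "\<lbrakk>a \<in> I; x \<in> carrier R\<rbrakk> \<Longrightarrow> x \<otimes> a \<in> I"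

definition Exp_set ::
    "(nat ^ 'n::finite \<Rightarrow> nat ^ 'n \<Rightarrow> bool) \<Rightarrow> ('n \<Rightarrow> 'v::finite) \<Rightarrow>
     (('k::field_char_0, 'v) mfps fract \<Rightarrow> ('k, 'v) mfps fract) set \<Rightarrow> (nat ^ 'n) set"
  where "Exp_set lt \<iota> I = {op_exp lt \<iota> P | P. P \<in> I - {\<lambda>_. 0}}"

definition coeff_ideal ::
    "(nat ^ 'n::finite \<Rightarrow> nat ^ 'n \<Rightarrow> bool) \<Rightarrow> ('n \<Rightarrow> 'v::finite) \<Rightarrow>
     ('k::field_char_0, 'v) mfps fract set \<Rightarrow> nat ^ 'n \<Rightarrow>
     (('k, 'v) mfps fract \<Rightarrow> ('k, 'v) mfps fract) set \<Rightarrow> ('k, 'v) mfps fract set"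
  where "coeff_ideal lt \<iota> H \<alpha> I =
    Idl\<^bsub>subalg_ring H\<^esub> {op_lead_coeff lt \<iota> P | P. P \<in> I - {\<lambda>_. 0} \<and> (\<exists>\<gamma>. \<alpha> = op_exp lt \<iota> P + \<gamma>)}"

text \<open>
  The left module of cosets modulo a left ideal. The ring-only fields of the module record
  carry no meaning.
\<close>

definition quotient_module ::
    "('n::finite \<Rightarrow> 'v::finite) \<Rightarrow> ('k::field_char_0, 'v) mfps fract set \<Rightarrow>
     (('k, 'v) mfps fract \<Rightarrow> ('k, 'v) mfps fract) set \<Rightarrow>
     (('k, 'v) mfps fract, (('k, 'v) mfps fract \<Rightarrow> ('k, 'v) mfps fract) set) module"
  where "quotient_module \<iota> H I =
    \<lparr>carrier = a_rcosets\<^bsub>diff_ops \<iota> H\<^esub> I, monoid.mult = undefined, one = undefined,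
     zero = I, add = (<+>\<^bsub>diff_ops \<iota> H\<^esub>),
     module.smult = (\<lambda>h C. \<Union>P\<in>C. I +>\<^bsub>diff_ops \<iota> H\<^esub> ((*) h \<otimes>\<^bsub>diff_ops \<iota> H\<^esub> P))\<rparr>"

lemma module_quotient_module:
  fixes H :: "('k::field_char_0, 'v::finite) mfps fract set"
  assumes H: "subring H ring_of_type_algebra"
    and I: "left_ideal I (diff_ops \<iota> H)"
  shows "module (subalg_ring H) (quotient_module \<iota> H I)"
proof -
  let ?D = "diff_ops \<iota> H" and ?M = "quotient_module \<iota> H I"
  interpret D: left_ideal I ?D by fact
  interpret A: abelian_subgroup I ?D
    by (rule abelian_subgroupI3) (rule D.is_additive_subgroup, rule D.abelian_group_axioms)
  have op: "(*) h \<in> carrier ?D" if "h \<in> H" for h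
    using that by (auto simp: diff_ops_def intro!: generate_ring.incl)
  have mlt: "(*) h \<otimes>\<^bsub>?D\<^esub> (*) k = (*) (h * k)" for h k
    by (auto simp: diff_ops_def End_ring_def fun_eq_iff)
  have pls: "(*) h \<oplus>\<^bsub>?D\<^esub> (*) k = (*) (h + k)" for h k
    by (auto simp: diff_ops_def End_ring_def fun_eq_iff algebra_simps)
  have one: "\<one>\<^bsub>?D\<^esub> = (*) 1"
    by (auto simp: diff_ops_def End_ring_def fun_eq_iff)
  have sm: "h \<odot>\<^bsub>?M\<^esub> (I +>\<^bsub>?D\<^esub> P) = I +>\<^bsub>?D\<^esub> ((*) h \<otimes>\<^bsub>?D\<^esub> P)" if "h \<in> H" "P \<in> carrier ?D" for h P
  proof -
    have "I +>\<^bsub>?D\<^esub> ((*) h \<otimes>\<^bsub>?D\<^esub> Q) = I +>\<^bsub>?D\<^esub> ((*) h \<otimes>\<^bsub>?D\<^esub> P)" if Q: "Q \<in> I +>\<^bsub>?D\<^esub> P" for Q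
    proof -
      from Q obtain i where i: "i \<in> I" "Q = i \<oplus>\<^bsub>?D\<^esub> P" by (auto simp: a_r_coset_def')
      have "(*) h \<otimes>\<^bsub>?D\<^esub> Q = ((*) h \<otimes>\<^bsub>?D\<^esub> i) \<oplus>\<^bsub>?D\<^esub> ((*) h \<otimes>\<^bsub>?D\<^esub> P)"
        using D.r_distr[OF _ \<open>P \<in> carrier ?D\<close> op[OF \<open>h \<in> H\<close>], of i] i D.a_subset by blast
      moreover have "(*) h \<otimes>\<^bsub>?D\<^esub> i \<in> I" using D.I_l_closed[OF i(1) op[OF \<open>h \<in> H\<close>]] .
      ultimately have "(*) h \<otimes>\<^bsub>?D\<^esub> Q \<in> I +>\<^bsub>?D\<^esub> ((*) h \<otimes>\<^bsub>?D\<^esub> P)"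
        unfolding a_r_coset_def' by blast
      from D.a_repr_independence[OF this D.m_closed[OF op[OF \<open>h \<in> H\<close>] \<open>P \<in> carrier ?D\<close>] D.a_subgroup]
      show ?thesis by (rule sym)
    qed
    moreover have "P \<in> I +>\<^bsub>?D\<^esub> P" using A.a_rcos_self[OF that(2)] .
    ultimately have "(\<Union>Q\<in>I +>\<^bsub>?D\<^esub> P. I +>\<^bsub>?D\<^esub> ((*) h \<otimes>\<^bsub>?D\<^esub> Q)) = I +>\<^bsub>?D\<^esub> ((*) h \<otimes>\<^bsub>?D\<^esub> P)"
      by blast
    then show ?thesis by (simp only: quotient_module_def module.simps)
  qed
  have car: "carrier ?M = a_rcosets\<^bsub>?D\<^esub> I" "add ?M = (<+>\<^bsub>?D\<^esub>)" "\<zero>\<^bsub>?M\<^esub> = I"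
    by (simp_all add: quotient_module_def)
  have C: "\<exists>P\<in>carrier ?D. x = I +>\<^bsub>?D\<^esub> P" if "x \<in> carrier ?M" for x
    using that by (auto simp: car A_RCOSETS_def')
  have "cring (subalg_ring H)"
    unfolding subalg_ring_def
    using ring.subcring_iff[OF ring_from_type_algebra, THEN iffD1, OF subringE(1)[OF H] cring.subcringI'[OF cring_from_type_algebra H]] .
  moreover have "abelian_group ?M"
  proof (rule abelian_groupI)
    have I0: "I = I +>\<^bsub>?D\<^esub> \<zero>\<^bsub>?D\<^esub>"
      using D.a_coset_join2[OF D.zero_closed D.a_subgroup] D.zero_closed by simp
    show "\<zero>\<^bsub>?M\<^esub> \<in> carrier ?M"
      unfolding car by (subst I0) (rule D.a_rcosetsI[OF D.a_subset D.zero_closed])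
    fix x assume "x \<in> carrier ?M"
    then obtain P where P: "P \<in> carrier ?D" "x = I +>\<^bsub>?D\<^esub> P" using C by blast
    show "\<zero>\<^bsub>?M\<^esub> \<oplus>\<^bsub>?M\<^esub> x = x"
      unfolding car P(2) by (subst (1) I0) (simp add: P A.a_rcos_sum)
    show "\<exists>y\<in>carrier ?M. y \<oplus>\<^bsub>?M\<^esub> x = \<zero>\<^bsub>?M\<^esub>"
    proof
      show "I +>\<^bsub>?D\<^esub> (\<ominus>\<^bsub>?D\<^esub> P) \<in> carrier ?M"
        unfolding car by (rule D.a_rcosetsI[OF D.a_subset D.a_inv_closed[OF P(1)]])
      show "(I +>\<^bsub>?D\<^esub> (\<ominus>\<^bsub>?D\<^esub> P)) \<oplus>\<^bsub>?M\<^esub> x = \<zero>\<^bsub>?M\<^esub>"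
        unfolding car P(2) by (simp add: P A.a_rcos_sum D.l_neg flip: I0)
    qed
    fix y assume "y \<in> carrier ?M"
    then obtain Q where Q: "Q \<in> carrier ?D" "y = I +>\<^bsub>?D\<^esub> Q" using C by blast
    show "x \<oplus>\<^bsub>?M\<^esub> y \<in> carrier ?M"
      using D.a_rcosetsI[OF D.a_subset D.a_closed[OF P(1) Q(1)]] by (simp add: car P Q A.a_rcos_sum)
    show "x \<oplus>\<^bsub>?M\<^esub> y = y \<oplus>\<^bsub>?M\<^esub> x"
      by (simp add: car P Q A.a_rcos_sum D.a_comm)
    fix z assume "z \<in> carrier ?M"
    then obtain R where R: "R \<in> carrier ?D" "z = I +>\<^bsub>?D\<^esub> R" using C by blast
    show "x \<oplus>\<^bsub>?M\<^esub> y \<oplus>\<^bsub>?M\<^esub> z = x \<oplus>\<^bsub>?M\<^esub> (y \<oplus>\<^bsub>?M\<^esub> z)"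
      by (simp add: car P Q R A.a_rcos_sum D.a_assoc)
  qed
  ultimately show ?thesis
  proof (rule moduleI)
    fix a b x y assume "a \<in> carrier (subalg_ring H)" and x: "x \<in> carrier ?M"
    then have a: "a \<in> H" by (simp add: subalg_ring_def)
    obtain P where P: "P \<in> carrier ?D" "x = I +>\<^bsub>?D\<^esub> P" using C x by blast
    show "a \<odot>\<^bsub>?M\<^esub> x \<in> carrier ?M"
      using D.a_rcosetsI[OF D.a_subset D.m_closed[OF op[OF a] P(1)]] a P by (simp add: sm, simp add: car)
    { assume "y \<in> carrier ?M"
      then obtain Q where "Q \<in> carrier ?D" "y = I +>\<^bsub>?D\<^esub> Q" using C by blast
      then show "a \<odot>\<^bsub>?M\<^esub> (x \<oplus>\<^bsub>?M\<^esub> y) = a \<odot>\<^bsub>?M\<^esub> x \<oplus>\<^bsub>?M\<^esub> a \<odot>\<^bsub>?M\<^esub> y"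
        using a P op[OF a] by (simp add: car sm A.a_rcos_sum D.r_distr) }
    { assume "b \<in> carrier (subalg_ring H)"
      then have b: "b \<in> H" by (simp add: subalg_ring_def)
      have ab: "a + b \<in> H" "a * b \<in> H" using subringE(6,7)[OF H a b] by (simp_all add: ring_of_type_algebra_def)
      show "(a \<oplus>\<^bsub>subalg_ring H\<^esub> b) \<odot>\<^bsub>?M\<^esub> x = a \<odot>\<^bsub>?M\<^esub> x \<oplus>\<^bsub>?M\<^esub> b \<odot>\<^bsub>?M\<^esub> x"
        using a b ab P op[OF a] op[OF b]
        by (simp add: subalg_ring_def ring_of_type_algebra_def sm car A.a_rcos_sum pls flip: D.l_distr)
      show "(a \<otimes>\<^bsub>subalg_ring H\<^esub> b) \<odot>\<^bsub>?M\<^esub> x = a \<odot>\<^bsub>?M\<^esub> (b \<odot>\<^bsub>?M\<^esub> x)"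
        using a b ab P op[OF a] op[OF b]
        by (simp add: subalg_ring_def ring_of_type_algebra_def sm car mlt flip: D.m_assoc) }
  next
    fix x assume x: "x \<in> carrier ?M"
    obtain P where P: "P \<in> carrier ?D" "x = I +>\<^bsub>?D\<^esub> P" using C x by blast
    have "1 \<in> H" using subringE(3)[OF H] by (simp add: ring_of_type_algebra_def)
    then show "\<one>\<^bsub>subalg_ring H\<^esub> \<odot>\<^bsub>?M\<^esub> x = x"
      using P by (simp add: subalg_ring_def ring_of_type_algebra_def sm flip: one)
  qed
qed

definition finitely_generated_module :: "('a, 'r) ring_scheme \<Rightarrow> ('a, 'b, 'm) module_scheme \<Rightarrow> bool"
  where "finitely_generated_module R M \<longleftrightarrow>
    (\<exists>S. finite S \<and> S \<subseteq> carrier M \<and>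
      (\<forall>x\<in>carrier M. \<exists>c\<in>S \<rightarrow> carrier R. x = (\<Oplus>\<^bsub>M\<^esub>s\<in>S. c s \<odot>\<^bsub>M\<^esub> s)))"

end

theory Submission
  imports Defs
begin

text \<open>
  Both directions pass through a third condition: for every \<open>i\<close> the ideal \<open>I\<close> contains an operator
  whose leading term is exactly \<open>\<partial>\<^sub>i\<^sup>a\<close>, with coefficient \<open>1\<close>.

  This is what the second condition of the theorem says
  (\<open>operator_left_ideal.monic_in_ideal_iff\<close>). Composing an operator with \<open>\<partial>\<^sup>\<gamma>\<close> on the left adds
  \<open>\<gamma>\<close> to its exponent and keeps its leading coefficient, because the derivatives of coefficients
  that the Leibniz rule creates stand at lower exponents. So every generator of \<open>C(\<alpha>; I)\<close> is the
  coefficient at \<open>\<alpha>\<close> of an operator in \<open>I\<close> of degree at most \<open>\<alpha>\<close>. Such coefficients already form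
  an ideal, and \<open>C(\<alpha>; I) = H\<close> says that \<open>1\<close> is one of them.

  If \<open>\<D>/I\<close> is finitely generated over the noetherian ring \<open>H\<close>, its submodules satisfy the
  ascending chain condition (\<open>module.ascending_submodules_stable\<close>). The submodules spanned by the
  classes of \<open>\<partial>\<^sub>i\<^sup>0, \<dots>, \<partial>\<^sub>i\<^sup>k\<^sup>-\<^sup>1\<close> therefore become stationary, so that some \<open>\<partial>\<^sub>i\<^sup>k\<close> is congruent
  modulo \<open>I\<close> to an \<open>H\<close>-combination of lower powers of \<open>\<partial>\<^sub>i\<close>. The difference is the required
  monic operator.

  Conversely, monic operators with exponents \<open>a\<^sub>i\<epsilon>\<^sub>i\<close> allow division: a term with exponent \<open>\<alpha>\<close>
  outside the box \<open>\<alpha>\<^sub>i < a\<^sub>i\<close> is cancelled by an \<open>H\<close>-multiple of \<open>\<partial>\<^sup>\<gamma>\<close> composed with one of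
  them. Since the order on exponents is well-founded, the finitely many classes of \<open>\<partial>\<^sup>\<alpha>\<close> with \<open>\<alpha>\<close> in the box generate \<open>\<D>/I\<close>.
\<close>

section \<open>Finitely generated modules over noetherian rings\<close>

lemma (in noetherian_ring) ascending_ideals_stable:
  assumes "\<And>k. ideal (J k) R" "mono (J :: nat \<Rightarrow> _)"
  shows "\<exists>k. \<forall>l. J l \<subseteq> J k"
proof -
  have "J k \<subseteq> J l \<or> J l \<subseteq> J k" for k l
    using assms(2) nat_le_linear[of k l] by (auto simp: mono_def)
  then have "subset.chain {I. ideal I R} (range J)"
    using assms(1) unfolding subset.chain_def by blast
  then have "\<Union> (range J) \<in> range J"
    by (intro ideal_chain_is_trivial) auto
  then show ?thesis by blast
qed

context module
begin

definition lin_span :: "'c set \<Rightarrow> 'c set"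
  where "lin_span S = (\<lambda>c. \<Oplus>\<^bsub>M\<^esub>s\<in>S. c s \<odot>\<^bsub>M\<^esub> s) ` (S \<rightarrow> carrier R)"

lemma minus_eq_smult: "x \<in> carrier M \<Longrightarrow> \<ominus>\<^bsub>M\<^esub> x = (\<ominus> \<one>) \<odot>\<^bsub>M\<^esub> x"
  by (simp add: smult_l_minus)

lemma lin_span_submodule:
  assumes S: "finite S" "S \<subseteq> carrier M"
  shows "submodule (lin_span S) R M"
proof (rule submoduleI)
  have summand: "c s \<odot>\<^bsub>M\<^esub> s \<in> carrier M" if "c \<in> S \<rightarrow> carrier R" "s \<in> S" for c s
    using that S by blast
  then show sub: "lin_span S \<subseteq> carrier M"
    unfolding lin_span_def by (auto intro!: finsum_closed)
  show smult: "a \<odot>\<^bsub>M\<^esub> x \<in> lin_span S" if "a \<in> carrier R" "x \<in> lin_span S" for a x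
  proof -
    from that obtain c where c: "c \<in> S \<rightarrow> carrier R" "x = (\<Oplus>\<^bsub>M\<^esub>s\<in>S. c s \<odot>\<^bsub>M\<^esub> s)"
      by (auto simp: lin_span_def)
    have "a \<odot>\<^bsub>M\<^esub> x = (\<Oplus>\<^bsub>M\<^esub>s\<in>S. a \<odot>\<^bsub>M\<^esub> (c s \<odot>\<^bsub>M\<^esub> s))"
      unfolding c(2) using S that(1) summand[OF c(1)] by (intro finsum_smult_ldistr) auto
    also have "\<dots> = (\<Oplus>\<^bsub>M\<^esub>s\<in>S. (a \<otimes> c s) \<odot>\<^bsub>M\<^esub> s)"
      using S c(1) that(1) by (intro M.finsum_cong') (auto simp: smult_assoc1 Pi_iff subset_iff)
    finally show ?thesis
      using c(1) that(1) unfolding lin_span_def by (intro image_eqI[where x = "\<lambda>s. a \<otimes> c s"]) auto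
  qed
  show "x \<oplus>\<^bsub>M\<^esub> y \<in> lin_span S" if xy: "x \<in> lin_span S" "y \<in> lin_span S" for x y
  proof -
    from xy obtain c d where c: "c \<in> S \<rightarrow> carrier R" "x = (\<Oplus>\<^bsub>M\<^esub>s\<in>S. c s \<odot>\<^bsub>M\<^esub> s)"
      and d: "d \<in> S \<rightarrow> carrier R" "y = (\<Oplus>\<^bsub>M\<^esub>s\<in>S. d s \<odot>\<^bsub>M\<^esub> s)"
      by (auto simp: lin_span_def)
    have "x \<oplus>\<^bsub>M\<^esub> y = (\<Oplus>\<^bsub>M\<^esub>s\<in>S. c s \<odot>\<^bsub>M\<^esub> s \<oplus>\<^bsub>M\<^esub> d s \<odot>\<^bsub>M\<^esub> s)"
      unfolding c(2) d(2) using summand[OF c(1)] summand[OF d(1)]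
      by (intro M.finsum_addf[symmetric]) auto
    also have "\<dots> = (\<Oplus>\<^bsub>M\<^esub>s\<in>S. (c s \<oplus> d s) \<odot>\<^bsub>M\<^esub> s)"
      using S c(1) d(1) by (intro M.finsum_cong') (auto simp: smult_l_distr Pi_iff subset_iff)
    finally show ?thesis
      using c(1) d(1) unfolding lin_span_def
      by (intro image_eqI[where x = "\<lambda>s. c s \<oplus> d s"]) auto
  qed
  show "\<ominus>\<^bsub>M\<^esub> x \<in> lin_span S" if "x \<in> lin_span S" for x
    using smult[OF _ that, of "\<ominus> \<one>"] that sub by (auto simp: minus_eq_smult)
  have "(\<Oplus>\<^bsub>M\<^esub>s\<in>S. \<zero> \<odot>\<^bsub>M\<^esub> s) = \<zero>\<^bsub>M\<^esub>"
    using S by (subst M.finsum_cong'[where g = "\<lambda>_. \<zero>\<^bsub>M\<^esub>" and B = S]) (auto simp: smult_l_null subset_iff)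
  then show "\<zero>\<^bsub>M\<^esub> \<in> lin_span S"
    unfolding lin_span_def by (intro image_eqI[where x = "\<lambda>_. \<zero>"]) auto
qed

lemma lin_span_base:
  assumes S: "finite S" "S \<subseteq> carrier M" and s: "s \<in> S"
  shows "s \<in> lin_span S"
proof -
  have "(\<Oplus>\<^bsub>M\<^esub>t\<in>S. (if s = t then \<one> else \<zero>) \<odot>\<^bsub>M\<^esub> t) = (\<Oplus>\<^bsub>M\<^esub>t\<in>S. if s = t then t else \<zero>\<^bsub>M\<^esub>)"
    using S by (intro M.finsum_cong') (auto simp: smult_l_null subset_iff)
  also have "\<dots> = s"
    using M.finsum_singleton[OF s S(1), of "\<lambda>t. t"] S(2) by auto
  finally show ?thesis
    unfolding lin_span_def by (intro image_eqI[where x = "\<lambda>t. if s = t then \<one> else \<zero>"]) auto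
qed

lemma lin_span_insertE:
  assumes "finite S" "insert s S \<subseteq> carrier M" "s \<notin> S" "x \<in> lin_span (insert s S)"
  obtains a t where "a \<in> carrier R" "t \<in> lin_span S" "x = a \<odot>\<^bsub>M\<^esub> s \<oplus>\<^bsub>M\<^esub> t"
proof -
  obtain c where c: "c \<in> insert s S \<rightarrow> carrier R" "x = (\<Oplus>\<^bsub>M\<^esub>t\<in>insert s S. c t \<odot>\<^bsub>M\<^esub> t)"
    using assms(4) by (auto simp: lin_span_def)
  have "x = c s \<odot>\<^bsub>M\<^esub> s \<oplus>\<^bsub>M\<^esub> (\<Oplus>\<^bsub>M\<^esub>t\<in>S. c t \<odot>\<^bsub>M\<^esub> t)"
    unfolding c(2) using assms c(1) by (intro M.finsum_insert) (auto simp: Pi_iff subset_iff)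
  moreover have "(\<Oplus>\<^bsub>M\<^esub>t\<in>S. c t \<odot>\<^bsub>M\<^esub> t) \<in> lin_span S"
    unfolding lin_span_def using c(1) by blast
  ultimately show ?thesis using that c(1) by blast
qed

text \<open>
  Induction on the number of generators. Modulo the span of \<open>S\<close>, a member of \<open>N k\<close> is determined by
  its coefficient at the further generator \<open>s\<close>, and these coefficients form an ideal \<open>J k\<close> of \<open>R\<close>.
  Once both \<open>J k\<close> and \<open>N k \<inter> lin_span S\<close> are stationary, so is \<open>N k\<close>.
\<close>

theorem ascending_submodules_stable:
  assumes noeth: "noetherian_ring R"
    and "finite S" "S \<subseteq> carrier M"
    and "\<And>k. submodule (N k) R M" "mono (N :: nat \<Rightarrow> _)" "\<And>k. N k \<subseteq> lin_span S"
  shows "\<exists>k. \<forall>l. N l \<subseteq> N k"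
  using assms(2-)
proof (induction S arbitrary: N rule: finite_induct)
  case empty
  have "N l \<subseteq> N 0" for l
    using empty(4)[of l] submoduleE(2)[OF empty(2)[of 0]] empty(4)[of 0] by (auto simp: lin_span_def)
  then show ?case by blast
next
  case (insert s S)
  have sM: "s \<in> carrier M" and SM: "S \<subseteq> carrier M" using insert.prems(1) by auto
  interpret S: submodule "lin_span S" R M by (rule lin_span_submodule[OF insert.hyps(1) SM])
  have SC: "t \<in> carrier M" if "t \<in> lin_span S" for t using S.mem_carrier[OF that] by simp
  note sub = submoduleE[OF insert.prems(2)]
  have NC: "t \<in> carrier M" if "t \<in> N k" for t k using sub(1) that by blast
  have N0: "\<zero>\<^bsub>M\<^esub> \<in> N k" for k
    using subgroup.one_closed[OF submodule.axioms(1)[OF insert.prems(2)[of k]]] by simp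
  have S0: "\<zero>\<^bsub>M\<^esub> \<in> lin_span S"
    using S.one_closed by simp
  define J where "J k = {a \<in> carrier R. \<exists>t\<in>lin_span S. a \<odot>\<^bsub>M\<^esub> s \<oplus>\<^bsub>M\<^esub> t \<in> N k}" for k
  have "ideal (J k) R" for k
  proof (rule idealI)
    have mult: "a \<otimes> b \<in> J k" if "a \<in> carrier R" "b \<in> J k" for a b
    proof -
      from that obtain t where t: "b \<in> carrier R" "t \<in> lin_span S" "b \<odot>\<^bsub>M\<^esub> s \<oplus>\<^bsub>M\<^esub> t \<in> N k"
        by (auto simp: J_def)
      have "(a \<otimes> b) \<odot>\<^bsub>M\<^esub> s \<oplus>\<^bsub>M\<^esub> a \<odot>\<^bsub>M\<^esub> t = a \<odot>\<^bsub>M\<^esub> (b \<odot>\<^bsub>M\<^esub> s \<oplus>\<^bsub>M\<^esub> t)"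
        using t SC sM that(1) by (simp add: smult_assoc1 smult_r_distr)
      then have "(a \<otimes> b) \<odot>\<^bsub>M\<^esub> s \<oplus>\<^bsub>M\<^esub> a \<odot>\<^bsub>M\<^esub> t \<in> N k"
        using sub(4)[OF that(1) t(3)] by simp
      then show ?thesis
        using t(1) S.smult_closed[OF that(1) t(2)] that(1) unfolding J_def by blast
    qed
    show "b \<otimes> a \<in> J k" if "a \<in> J k" "b \<in> carrier R" for a b
      using mult that by blast
    then show "a \<otimes> b \<in> J k" if "a \<in> J k" "b \<in> carrier R" for a b
      using that m_comm[of a b] by (auto simp: J_def)
    show "subgroup (J k) (add_monoid R)"
    proof
      show "J k \<subseteq> carrier (add_monoid R)" by (auto simp: J_def)
      show "\<one>\<^bsub>add_monoid R\<^esub> \<in> J k"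
        using S0 N0 sM by (auto simp: J_def smult_l_null intro!: bexI[of _ "\<zero>\<^bsub>M\<^esub>"])
      fix a assume a: "a \<in> J k"
      then have "a \<in> carrier R" by (simp add: J_def)
      then have "inv\<^bsub>add_monoid R\<^esub> a = (\<ominus> \<one>) \<otimes> a"
        by (simp add: l_minus a_inv_def[symmetric])
      with mult[OF _ a, of "\<ominus> \<one>"] show "inv\<^bsub>add_monoid R\<^esub> a \<in> J k" by simp
      fix b assume b: "b \<in> J k"
      from a obtain t where t: "a \<in> carrier R" "t \<in> lin_span S" "a \<odot>\<^bsub>M\<^esub> s \<oplus>\<^bsub>M\<^esub> t \<in> N k"
        by (auto simp: J_def)
      from b obtain u where u: "b \<in> carrier R" "u \<in> lin_span S" "b \<odot>\<^bsub>M\<^esub> s \<oplus>\<^bsub>M\<^esub> u \<in> N k"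
        by (auto simp: J_def)
      have "(a \<oplus> b) \<odot>\<^bsub>M\<^esub> s \<oplus>\<^bsub>M\<^esub> (t \<oplus>\<^bsub>M\<^esub> u) = (a \<odot>\<^bsub>M\<^esub> s \<oplus>\<^bsub>M\<^esub> t) \<oplus>\<^bsub>M\<^esub> (b \<odot>\<^bsub>M\<^esub> s \<oplus>\<^bsub>M\<^esub> u)"
        using t u SC sM by (simp add: smult_l_distr M.a_ac)
      then have "(a \<oplus> b) \<odot>\<^bsub>M\<^esub> s \<oplus>\<^bsub>M\<^esub> (t \<oplus>\<^bsub>M\<^esub> u) \<in> N k" using sub(5)[OF t(3) u(3)] by simp
      moreover have "t \<oplus>\<^bsub>M\<^esub> u \<in> lin_span S" using S.m_closed[OF t(2) u(2)] by simp
      ultimately show "a \<otimes>\<^bsub>add_monoid R\<^esub> b \<in> J k" using t(1) u(1) by (auto simp: J_def)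
    qed
  qed (rule ring_axioms)
  moreover have "mono J"
    using insert.prems(3) by (fastforce simp: mono_def J_def)
  ultimately obtain k where k: "\<And>l. J l \<subseteq> J k"
    using noetherian_ring.ascending_ideals_stable[OF noeth] by blast
  have "\<exists>k. \<forall>l. N l \<inter> lin_span S \<subseteq> N k \<inter> lin_span S"
  proof (rule insert.IH[OF SM])
    show "submodule (N k \<inter> lin_span S) R M" for k
      using sub S0 N0 submoduleE[OF S.submodule_axioms]
      by (intro submoduleI) auto
    show "mono (\<lambda>k. N k \<inter> lin_span S)" using insert.prems(3) by (fastforce simp: mono_def)
  qed auto
  then obtain k' where k': "\<And>l. N l \<inter> lin_span S \<subseteq> N k'" by blast
  have "x \<in> N (max k k')" if x: "x \<in> N l" for x l
  proof -
    define m where "m = max (max k k') l"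
    have xm: "x \<in> N m" and le: "N k \<subseteq> N (max k k')" "N k' \<subseteq> N (max k k')" "N (max k k') \<subseteq> N m"
      using x monoD[OF insert.prems(3), of l m] by (auto simp: m_def intro!: monoD[OF insert.prems(3)])
    from x have "x \<in> lin_span (insert s S)" using insert.prems(4) by blast
    then obtain a t where at: "a \<in> carrier R" "t \<in> lin_span S" "x = a \<odot>\<^bsub>M\<^esub> s \<oplus>\<^bsub>M\<^esub> t"
      using lin_span_insertE insert.hyps insert.prems(1) by metis
    then have "a \<in> J l" using x by (auto simp: J_def)
    then obtain u where u: "u \<in> lin_span S" "a \<odot>\<^bsub>M\<^esub> s \<oplus>\<^bsub>M\<^esub> u \<in> N k"
      using k by (auto simp: J_def)
    \<comment> \<open>\<open>x\<close> and \<open>?y\<close> agree at \<open>s\<close>, so their difference lies in the part that \<open>k'\<close> controls.\<close>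
    let ?y = "a \<odot>\<^bsub>M\<^esub> s \<oplus>\<^bsub>M\<^esub> u"
    have as: "a \<odot>\<^bsub>M\<^esub> s \<in> carrier M" using at(1) sM by simp
    have "x \<oplus>\<^bsub>M\<^esub> \<ominus>\<^bsub>M\<^esub> ?y = t \<oplus>\<^bsub>M\<^esub> \<ominus>\<^bsub>M\<^esub> u"
      using as SC[OF at(2)] SC[OF u(1)] unfolding at(3)
      by (simp add: M.minus_add M.a_ac M.r_neg M.r_neg1 M.r_neg2)
    moreover have "t \<oplus>\<^bsub>M\<^esub> \<ominus>\<^bsub>M\<^esub> u \<in> lin_span S"
      using submoduleE(3,5)[OF S.submodule_axioms] at(2) u(1) by blast
    moreover have "x \<oplus>\<^bsub>M\<^esub> \<ominus>\<^bsub>M\<^esub> ?y \<in> N m"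
      using sub(3,5)[of _ m] xm u(2) le by blast
    ultimately have "x \<oplus>\<^bsub>M\<^esub> \<ominus>\<^bsub>M\<^esub> ?y \<in> N (max k k')" using k'[of m] le by auto
    then have "(x \<oplus>\<^bsub>M\<^esub> \<ominus>\<^bsub>M\<^esub> ?y) \<oplus>\<^bsub>M\<^esub> ?y \<in> N (max k k')"
      using sub(5) u(2) le(1) by blast
    moreover have "(x \<oplus>\<^bsub>M\<^esub> \<ominus>\<^bsub>M\<^esub> ?y) \<oplus>\<^bsub>M\<^esub> ?y = x"
      using NC[OF x] NC[OF u(2)] by (simp add: M.a_assoc M.l_neg)
    ultimately show ?thesis by simp
  qed
  then show ?case by blast
qed

end


section \<open>Multi-indices and monomial orders\<close>

lemma multi_index_induct [case_names zero step]:
  fixes \<alpha> :: "nat ^ 'n::finite"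
  assumes "P 0" "\<And>\<alpha> i. P \<alpha> \<Longrightarrow> P (\<alpha> + axis i 1)"
  shows "P \<alpha>"
proof (induction "\<Sum>i\<in>UNIV. \<alpha> $ i" arbitrary: \<alpha> rule: less_induct)
  case less
  show ?case
  proof (cases "\<alpha> = 0")
    case False
    then obtain i where i: "\<alpha> $ i > 0" by (auto simp: vec_eq_iff)
    then have \<alpha>: "\<alpha> = (\<alpha> - axis i 1) + axis i 1" by (auto simp: vec_eq_iff axis_def)
    have "(\<Sum>j\<in>UNIV. (\<alpha> - axis i 1) $ j) < (\<Sum>j\<in>UNIV. \<alpha> $ j)"
      using i by (intro sum_strict_mono_ex1) (auto simp: axis_def)
    from assms(2)[OF less[OF this], of i] show ?thesis using \<alpha> by simp
  qed (use assms(1) in simp)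
qed

lemma finite_multi_index_box: "finite {\<alpha> :: nat ^ 'n::finite. \<forall>i. \<alpha> $ i < a i}"
proof (rule finite_subset)
  show "{\<alpha> :: nat ^ 'n. \<forall>i. \<alpha> $ i < a i} \<subseteq> vec_lambda ` (PiE UNIV (\<lambda>i. {..<a i}))"
  proof
    fix \<alpha> :: "nat ^ 'n" assume "\<alpha> \<in> {\<alpha>. \<forall>i. \<alpha> $ i < a i}"
    then show "\<alpha> \<in> vec_lambda ` (PiE UNIV (\<lambda>i. {..<a i}))"
      by (intro image_eqI[of _ _ "vec_nth \<alpha>"]) auto
  qed
qed (intro finite_imageI finite_PiE, auto)

context monomial_order
begin

text \<open>
  A negative \<open>\<gamma>\<close> would give the infinite descent \<open>\<alpha> > \<alpha> + \<gamma> > \<alpha> + 2\<gamma> > \<dots>\<close>; as no \<open>\<alpha>\<close> is minimal,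
  well-founded induction proves \<open>False\<close>.
\<close>

lemma not_less_zero: "\<not> lt \<gamma> 0"
proof
  assume "lt \<gamma> 0"
  then have step: "lt (\<gamma> + \<alpha>) \<alpha>" for \<alpha> using add_less_iff[of \<gamma> \<alpha> 0] by simp
  have "False" for \<alpha> :: "nat ^ 'n"
    by (induction \<alpha> rule: less_induct) (use step in blast)
  then show False .
qed

lemma less_add: "\<gamma> \<noteq> 0 \<Longrightarrow> lt \<alpha> (\<alpha> + \<gamma>)"
  using add_less_iff[of 0 \<alpha> \<gamma>] not_less_zero[of \<gamma>] less_linear[of 0 \<gamma>] by (auto simp: add.commute)

lemma axis_less: "j < k \<Longrightarrow> lt (axis i j) (axis i k)"
proof -
  assume "j < k"
  then have "axis i k = axis i j + axis i (k - j)" "axis i (k - j) \<noteq> 0"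
    by (auto simp: vec_eq_iff axis_def)
  then show ?thesis using less_add by metis
qed

end

section \<open>Expansions of differential operators\<close>

lemma is_expansionI:
  assumes "finite A" "\<And>\<alpha>. \<alpha> \<notin> A \<Longrightarrow> p \<alpha> = 0"
    and "\<And>z. P z = (\<Sum>\<alpha>\<in>A. p \<alpha> * fract_derivs \<iota> \<alpha> z)"
  shows "is_expansion \<iota> P p"
proof -
  have "P z = (\<Sum>\<alpha> | p \<alpha> \<noteq> 0. p \<alpha> * fract_derivs \<iota> \<alpha> z)" for z
    unfolding assms(3) using assms(1,2) by (intro sum.mono_neutral_right) auto
  moreover have "finite {\<alpha>. p \<alpha> \<noteq> 0}"
    by (rule finite_subset[OF _ assms(1)]) (use assms(2) in blast)
  ultimately show ?thesis by (auto simp: is_expansion_def)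
qed

lemma is_expansion_sum:
  assumes "is_expansion \<iota> P p" "finite A" "{\<alpha>. p \<alpha> \<noteq> 0} \<subseteq> A"
  shows "P z = (\<Sum>\<alpha>\<in>A. p \<alpha> * fract_derivs \<iota> \<alpha> z)"
proof -
  have "P z = (\<Sum>\<alpha> | p \<alpha> \<noteq> 0. p \<alpha> * fract_derivs \<iota> \<alpha> z)"
    using assms(1) by (auto simp: is_expansion_def)
  also have "\<dots> = (\<Sum>\<alpha>\<in>A. p \<alpha> * fract_derivs \<iota> \<alpha> z)"
    using assms(2,3) by (intro sum.mono_neutral_left) auto
  finally show ?thesis .
qed

lemma is_expansion_zero: "is_expansion \<iota> (\<lambda>_. 0) (\<lambda>_. 0)"
  by (rule is_expansionI[of "{}"]) auto

lemma is_expansion_fract_derivs: "is_expansion \<iota> (fract_derivs \<iota> \<alpha>) (\<lambda>\<beta>. of_bool (\<beta> = \<alpha>))"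
  by (rule is_expansionI[of "{\<alpha>}"]) auto

lemma is_expansion_add:
  assumes "is_expansion \<iota> P p" "is_expansion \<iota> Q q"
  shows "is_expansion \<iota> (\<lambda>z. P z + Q z) (\<lambda>\<alpha>. p \<alpha> + q \<alpha>)"
proof (rule is_expansionI)
  let ?A = "{\<alpha>. p \<alpha> \<noteq> 0} \<union> {\<alpha>. q \<alpha> \<noteq> 0}"
  show fin: "finite ?A" using assms by (simp add: is_expansion_def)
  show "P z + Q z = (\<Sum>\<alpha>\<in>?A. (p \<alpha> + q \<alpha>) * fract_derivs \<iota> \<alpha> z)" for z
    unfolding is_expansion_sum[OF assms(1) fin Un_upper1] is_expansion_sum[OF assms(2) fin Un_upper2]
    by (simp add: sum.distrib ring_distribs)
qed auto

lemma is_expansion_scale: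
  assumes "is_expansion \<iota> P p"
  shows "is_expansion \<iota> (\<lambda>z. h * P z) (\<lambda>\<alpha>. h * p \<alpha>)"
proof (rule is_expansionI)
  show fin: "finite {\<alpha>. p \<alpha> \<noteq> 0}" using assms by (simp add: is_expansion_def)
  show "h * P z = (\<Sum>\<alpha> | p \<alpha> \<noteq> 0. (h * p \<alpha>) * fract_derivs \<iota> \<alpha> z)" for z
    unfolding is_expansion_sum[OF assms fin subset_refl]
    by (simp add: sum_distrib_left mult.assoc)
qed auto

text \<open>
  The Leibniz rule \<open>\<partial>\<^sub>i (p \<partial>\<^sup>\<alpha>) = p \<partial>\<^sup>\<alpha>\<^sup>+\<^sup>\<epsilon> + \<partial>\<^sub>i(p) \<partial>\<^sup>\<alpha>\<close> with \<open>\<epsilon> = \<epsilon>\<^sub>i\<close>. The case distinction keeps the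
  truncated difference \<open>\<beta> - \<epsilon>\<close> from contributing where \<open>\<beta>\<close> is not of the form \<open>\<alpha> + \<epsilon>\<close>.
\<close>

lemma is_expansion_deriv:
  fixes \<iota> :: "'n::finite \<Rightarrow> 'v::finite"
  assumes P: "is_expansion \<iota> P p"
  shows "is_expansion \<iota> (fract_deriv (\<iota> i) \<circ> P)
    (\<lambda>\<beta>. fract_deriv (\<iota> i) (p \<beta>) + (if \<beta> $ i = 0 then 0 else p (\<beta> - axis i 1)))"
proof -
  let ?A = "{\<alpha>. p \<alpha> \<noteq> 0}" and ?e = "axis i 1 :: nat ^ 'n"
  let ?q = "\<lambda>\<beta>. if \<beta> $ i = 0 then 0 else p (\<beta> - ?e)"
  have fin: "finite ?A" using P by (simp add: is_expansion_def)
  have unshift: "\<beta> = (\<beta> - ?e) + ?e" if "\<beta> $ i \<noteq> 0" for \<beta>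
    using that by (auto simp: vec_eq_iff axis_def)
  have "is_expansion \<iota> (\<lambda>z. \<Sum>\<alpha>\<in>?A. fract_deriv (\<iota> i) (p \<alpha>) * fract_derivs \<iota> \<alpha> z)
      (\<lambda>\<beta>. fract_deriv (\<iota> i) (p \<beta>))"
    by (rule is_expansionI[OF fin]) auto
  moreover have "is_expansion \<iota> (\<lambda>z. \<Sum>\<alpha>\<in>?A. p \<alpha> * fract_derivs \<iota> (\<alpha> + ?e) z) ?q"
  proof (rule is_expansionI)
    show "finite ((\<lambda>\<alpha>. \<alpha> + ?e) ` ?A)" using fin by simp
    show "?q \<beta> = 0" if "\<beta> \<notin> (\<lambda>\<alpha>. \<alpha> + ?e) ` ?A" for \<beta>
      using that unshift[of \<beta>] by (metis (mono_tags, lifting) image_eqI mem_Collect_eq)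
    show "(\<Sum>\<alpha>\<in>?A. p \<alpha> * fract_derivs \<iota> (\<alpha> + ?e) z) =
        (\<Sum>\<beta>\<in>(\<lambda>\<alpha>. \<alpha> + ?e) ` ?A. ?q \<beta> * fract_derivs \<iota> \<beta> z)" for z
      by (subst sum.reindex) (auto simp: inj_on_def intro!: sum.cong)
  qed
  ultimately have "is_expansion \<iota> (\<lambda>z. (\<Sum>\<alpha>\<in>?A. fract_deriv (\<iota> i) (p \<alpha>) * fract_derivs \<iota> \<alpha> z) +
      (\<Sum>\<alpha>\<in>?A. p \<alpha> * fract_derivs \<iota> (\<alpha> + ?e) z)) (\<lambda>\<beta>. fract_deriv (\<iota> i) (p \<beta>) + ?q \<beta>)"
    by (rule is_expansion_add)
  moreover have "(\<Sum>\<alpha>\<in>?A. fract_deriv (\<iota> i) (p \<alpha>) * fract_derivs \<iota> \<alpha> z) +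
      (\<Sum>\<alpha>\<in>?A. p \<alpha> * fract_derivs \<iota> (\<alpha> + ?e) z) = (fract_deriv (\<iota> i) \<circ> P) z" for z
    by (simp add: is_expansion_sum[OF P fin subset_refl] fract_deriv_sum fract_deriv_mult
        fract_deriv_fract_derivs sum.distrib)
  ultimately show ?thesis by (simp only: o_def)
qed

section \<open>Left ideals of differential operators and leading terms\<close>

locale operator_left_ideal =
  left_ideal I "diff_ops \<iota> H" + ord: monomial_order lt
  for I :: "(('k::field_char_0, 'v::finite) mfps fract \<Rightarrow> ('k, 'v) mfps fract) set"
    and \<iota> :: "'n::finite \<Rightarrow> 'v" and H and lt :: "nat ^ 'n \<Rightarrow> nat ^ 'n \<Rightarrow> bool" +
  assumes inj: "inj \<iota>"
    and H_subring: "subring H ring_of_type_algebra"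
    and H_stable: "h \<in> H \<Longrightarrow> fract_deriv (\<iota> i) h \<in> H"
begin

abbreviation "\<D> \<equiv> diff_ops \<iota> H"
abbreviation "coefficient \<equiv> op_coeff \<iota>"

lemma H_closed:
  "0 \<in> H" "1 \<in> H" "- 1 \<in> H" "a \<in> H \<Longrightarrow> b \<in> H \<Longrightarrow> a + b \<in> H" "a \<in> H \<Longrightarrow> b \<in> H \<Longrightarrow> a * b \<in> H"
proof -
  interpret T: ring "ring_of_type_algebra :: ('k, 'v) mfps fract ring"
    by (rule ring_from_type_algebra)
  have "\<ominus>\<^bsub>ring_of_type_algebra\<^esub> 1 = (- 1 :: ('k, 'v) mfps fract)"
    by (rule T.minus_equality) (simp_all add: ring_of_type_algebra_def)
  moreover show "0 \<in> H" "1 \<in> H" "a \<in> H \<Longrightarrow> b \<in> H \<Longrightarrow> a + b \<in> H" "a \<in> H \<Longrightarrow> b \<in> H \<Longrightarrow> a * b \<in> H"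
    using subringE[OF H_subring] by (simp_all add: ring_of_type_algebra_def)
  ultimately show "- 1 \<in> H" using subringE(5)[OF H_subring, of 1] by simp
qed

lemma subalg_ring_simps [simp]:
  "carrier (subalg_ring H) = H" "\<one>\<^bsub>subalg_ring H\<^esub> = 1" "\<zero>\<^bsub>subalg_ring H\<^esub> = 0"
  "a \<otimes>\<^bsub>subalg_ring H\<^esub> b = a * b" "a \<oplus>\<^bsub>subalg_ring H\<^esub> b = a + b"
  by (simp_all add: subalg_ring_def ring_of_type_algebra_def)

lemma ops_simps [simp]:
  "P \<otimes>\<^bsub>\<D>\<^esub> Q = P \<circ> Q" "P \<oplus>\<^bsub>\<D>\<^esub> Q = (\<lambda>z. P z + Q z)" "\<zero>\<^bsub>\<D>\<^esub> = (\<lambda>_. 0)" "\<one>\<^bsub>\<D>\<^esub> = id"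
  by (simp_all add: diff_ops_def End_ring_def)

lemma mult_op: "h \<in> H \<Longrightarrow> (*) h \<in> carrier \<D>"
  and deriv_op: "fract_deriv (\<iota> i) \<in> carrier \<D>"
  by (auto simp: diff_ops_def intro!: generate_ring.incl)

lemma ops_add: "P \<in> carrier \<D> \<Longrightarrow> Q \<in> carrier \<D> \<Longrightarrow> (\<lambda>z. P z + Q z) \<in> carrier \<D>"
  using a_closed[of P Q] by simp

lemma ops_scale: "h \<in> H \<Longrightarrow> P \<in> carrier \<D> \<Longrightarrow> (\<lambda>z. h * P z) \<in> carrier \<D>"
  using m_closed[OF mult_op, of h P] by (simp add: comp_def)

lemma ops_deriv: "P \<in> carrier \<D> \<Longrightarrow> fract_deriv (\<iota> i) \<circ> P \<in> carrier \<D>"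
  using m_closed[OF deriv_op, of P] by simp

lemma ops_fract_derivs: "fract_derivs \<iota> \<alpha> \<in> carrier \<D>"
proof (induction \<alpha> rule: multi_index_induct)
  case zero
  then show ?case using one_closed by (simp add: fract_derivs_0 del: id_apply flip: id_def)
next
  case (step \<alpha> i)
  have "fract_deriv (\<iota> i) \<circ> fract_derivs \<iota> \<alpha> = fract_derivs \<iota> (\<alpha> + axis i 1)"
    using fract_deriv_fract_derivs by (rule ext[OF trans[OF comp_apply]])
  from ops_deriv[OF step, where i = i, unfolded this] show ?case .
qed

lemma ideal_ops: "P \<in> I \<Longrightarrow> P \<in> carrier \<D>"
  using a_subset by blast

lemma ideal_add: "P \<in> I \<Longrightarrow> Q \<in> I \<Longrightarrow> (\<lambda>z. P z + Q z) \<in> I"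
  using additive_subgroup.a_closed[OF is_additive_subgroup, of P Q] by simp

lemma ideal_scale: "h \<in> H \<Longrightarrow> P \<in> I \<Longrightarrow> (\<lambda>z. h * P z) \<in> I"
  using I_l_closed[OF _ mult_op, of P h] by (simp add: comp_def)

lemma ideal_deriv: "P \<in> I \<Longrightarrow> fract_deriv (\<iota> i) \<circ> P \<in> I"
  using I_l_closed[OF _ deriv_op, of P] by simp

lemma zero_in_ideal: "(\<lambda>_. 0) \<in> I"
  using additive_subgroup.zero_closed[OF is_additive_subgroup] by simp

lemma expansion:
  assumes "P \<in> carrier \<D>"
  shows "is_expansion \<iota> P (coefficient P)" "coefficient P \<alpha> \<in> H" "finite {\<alpha>. coefficient P \<alpha> \<noteq> 0}"
proof -
  obtain p where p: "is_expansion \<iota> P p" "range p \<subseteq> H"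
    using diff_ops_expansion[OF H_subring H_stable assms] by blast
  with op_coeff_eqI[OF inj p(1)]
  show "is_expansion \<iota> P (coefficient P)" "coefficient P \<alpha> \<in> H" "finite {\<alpha>. coefficient P \<alpha> \<noteq> 0}"
    by (auto simp: is_expansion_def)
qed

lemma coeff_zero: "coefficient (\<lambda>_. 0) = (\<lambda>_. 0)"
  by (rule op_coeff_eqI[OF inj is_expansion_zero])

lemma coeff_fract_derivs: "coefficient (fract_derivs \<iota> \<alpha>) = (\<lambda>\<beta>. of_bool (\<beta> = \<alpha>))"
  by (rule op_coeff_eqI[OF inj is_expansion_fract_derivs])

lemma coeff_add:
  "P \<in> carrier \<D> \<Longrightarrow> Q \<in> carrier \<D> \<Longrightarrow> coefficient (\<lambda>z. P z + Q z) = (\<lambda>\<alpha>. coefficient P \<alpha> + coefficient Q \<alpha>)"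
  by (intro op_coeff_eqI[OF inj] is_expansion_add expansion(1))

lemma coeff_scale:
  "P \<in> carrier \<D> \<Longrightarrow> coefficient (\<lambda>z. h * P z) = (\<lambda>\<alpha>. h * coefficient P \<alpha>)"
  by (intro op_coeff_eqI[OF inj] is_expansion_scale expansion(1))

lemma coeff_deriv:
  "P \<in> carrier \<D> \<Longrightarrow> coefficient (fract_deriv (\<iota> i) \<circ> P) =
    (\<lambda>\<beta>. fract_deriv (\<iota> i) (coefficient P \<beta>) + (if \<beta> $ i = 0 then 0 else coefficient P (\<beta> - axis i 1)))"
  by (intro op_coeff_eqI[OF inj] is_expansion_deriv expansion(1))

lemma zero_if_coeffs_zero:
  assumes "P \<in> carrier \<D>" "\<And>\<alpha>. coefficient P \<alpha> = 0"
  shows "P = (\<lambda>_. 0)"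
  using is_expansion_sum[OF expansion(1)[OF assms(1)], of "{}"] assms(2) by auto

text \<open>
  Bounding the exponent instead of fixing it admits the zero operator and operators whose
  coefficient at \<open>\<alpha>\<close> vanishes; so the operators in question form a left \<open>H\<close>-module.
\<close>

definition degree_le :: "nat ^ 'n \<Rightarrow> (('k, 'v) mfps fract \<Rightarrow> ('k, 'v) mfps fract) \<Rightarrow> bool"
  where "degree_le \<alpha> P \<longleftrightarrow> (\<forall>\<beta>. coefficient P \<beta> \<noteq> 0 \<longrightarrow> \<beta> = \<alpha> \<or> lt \<beta> \<alpha>)"

lemma degree_le_op_exp: "P \<in> carrier \<D> \<Longrightarrow> degree_le (op_exp lt \<iota> P) P"
  using op_exp_greatest(2)[OF ord.monomial_order_axioms expansion(3)] by (auto simp: degree_le_def)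

lemma coeff_op_exp_nonzero:
  assumes "P \<in> carrier \<D>" "P \<noteq> (\<lambda>_. 0)"
  shows "coefficient P (op_exp lt \<iota> P) \<noteq> 0"
proof -
  obtain \<alpha> where "coefficient P \<alpha> \<noteq> 0" using zero_if_coeffs_zero assms by blast
  from op_exp_greatest(1)[OF ord.monomial_order_axioms expansion(3)[OF assms(1)] this]
  show ?thesis by (simp add: op_lead_coeff_def)
qed

lemma op_exp_eqI:
  assumes "P \<in> carrier \<D>" "degree_le \<alpha> P" "coefficient P \<alpha> \<noteq> 0"
  shows "op_exp lt \<iota> P = \<alpha>"
proof -
  have "P \<noteq> (\<lambda>_. 0)" using assms(3) by (auto simp: coeff_zero)
  from coeff_op_exp_nonzero[OF assms(1) this] degree_le_op_exp[OF assms(1)] assms(2,3)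
  show ?thesis unfolding degree_le_def using ord.less_asym by metis
qed

lemma degree_le_add:
  "\<lbrakk>P \<in> carrier \<D>; Q \<in> carrier \<D>; degree_le \<alpha> P; degree_le \<alpha> Q\<rbrakk> \<Longrightarrow> degree_le \<alpha> (\<lambda>z. P z + Q z)"
  by (auto simp: degree_le_def coeff_add) (metis add_0)

lemma degree_le_scale: "\<lbrakk>P \<in> carrier \<D>; degree_le \<alpha> P\<rbrakk> \<Longrightarrow> degree_le \<alpha> (\<lambda>z. h * P z)"
  by (auto simp: degree_le_def coeff_scale)

text \<open>
  In the Leibniz rule the top term comes from the shift alone: differentiating the coefficients
  enlarges no exponent.
\<close>

lemma degree_le_deriv:
  assumes P: "P \<in> carrier \<D>" "degree_le \<alpha> P"
  shows "degree_le (\<alpha> + axis i 1) (fract_deriv (\<iota> i) \<circ> P)"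
    and "coefficient (fract_deriv (\<iota> i) \<circ> P) (\<alpha> + axis i 1) = coefficient P \<alpha>"
proof -
  have less: "lt \<alpha> (\<alpha> + axis i 1)"
    by (rule ord.less_add) (auto simp: vec_eq_iff axis_def)
  show "degree_le (\<alpha> + axis i 1) (fract_deriv (\<iota> i) \<circ> P)"
    unfolding degree_le_def
  proof (intro allI impI)
    fix \<beta> assume "coefficient (fract_deriv (\<iota> i) \<circ> P) \<beta> \<noteq> 0"
    then consider "coefficient P \<beta> \<noteq> 0" | "\<beta> $ i \<noteq> 0" "coefficient P (\<beta> - axis i 1) \<noteq> 0"
      by (cases "coefficient P \<beta> = 0") (auto simp: coeff_deriv[OF P(1)] split: if_splits)
    then show "\<beta> = \<alpha> + axis i 1 \<or> lt \<beta> (\<alpha> + axis i 1)"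
    proof cases
      case 1
      with P(2) less show ?thesis using ord.less_trans by (auto simp: degree_le_def)
    next
      case 2
      then have "\<beta> = (\<beta> - axis i 1) + axis i 1" by (auto simp: vec_eq_iff axis_def)
      moreover have "\<beta> - axis i 1 = \<alpha> \<or> lt (\<beta> - axis i 1) \<alpha>" using P(2) 2 by (simp add: degree_le_def)
      ultimately show ?thesis using ord.add_less_iff by metis
    qed
  qed
  have "coefficient P (\<alpha> + axis i 1) = 0"
    using P(2) less ord.less_asym ord.less_irrefl unfolding degree_le_def by metis
  then show "coefficient (fract_deriv (\<iota> i) \<circ> P) (\<alpha> + axis i 1) = coefficient P \<alpha>"
    by (simp add: coeff_deriv[OF P(1)])
qed

lemma shift_in_ideal:
  assumes "P \<in> I" "degree_le \<alpha> P"
  shows "\<exists>Q\<in>I. degree_le (\<alpha> + \<gamma>) Q \<and> coefficient Q (\<alpha> + \<gamma>) = coefficient P \<alpha>"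
proof (induction \<gamma> rule: multi_index_induct)
  case zero
  then show ?case using assms by auto
next
  case (step \<gamma> i)
  then obtain Q where Q: "Q \<in> I" "degree_le (\<alpha> + \<gamma>) Q" "coefficient Q (\<alpha> + \<gamma>) = coefficient P \<alpha>" by blast
  with ideal_deriv[OF Q(1)] degree_le_deriv[OF ideal_ops[OF Q(1)] Q(2)] show ?case
    by (auto simp: add.assoc intro!: bexI[of _ "fract_deriv (\<iota> i) \<circ> Q"])
qed

lemma ring_subalg: "ring (subalg_ring H)"
  using ring.subring_is_ring[OF ring_from_type_algebra H_subring] by (simp add: subalg_ring_def)

text \<open>
  The right-hand side contains the generators of \<open>C(\<alpha>; I)\<close> by \<open>shift_in_ideal\<close>, and it is closed
  under sums and multiples because all its operators are compared at the same exponent. This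
  turns membership in the generated ideal into the existence of a single operator.
\<close>

lemma coeff_ideal_eq:
  "coeff_ideal lt \<iota> H \<alpha> I = {coefficient P \<alpha> | P. P \<in> I \<and> degree_le \<alpha> P}" (is "_ = ?L")
proof
  let ?G = "{op_lead_coeff lt \<iota> P | P. P \<in> I - {\<lambda>_. 0} \<and> (\<exists>\<gamma>. \<alpha> = op_exp lt \<iota> P + \<gamma>)}"
  interpret R: ring "subalg_ring H" by (rule ring_subalg)
  have L_scale: "h * c \<in> ?L" if h: "h \<in> H" and c: "c \<in> ?L" for h c
  proof -
    obtain P where P: "P \<in> I" "degree_le \<alpha> P" "c = coefficient P \<alpha>" using c by blast
    then have "(\<lambda>z. h * P z) \<in> I" "degree_le \<alpha> (\<lambda>z. h * P z)" "h * c = coefficient (\<lambda>z. h * P z) \<alpha>"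
      using ideal_scale[OF h] ideal_ops degree_le_scale by (simp_all add: coeff_scale)
    then show ?thesis by blast
  qed
  have L_add: "c + d \<in> ?L" if c: "c \<in> ?L" and d: "d \<in> ?L" for c d
  proof -
    obtain P where P: "P \<in> I" "degree_le \<alpha> P" "c = coefficient P \<alpha>" using c by blast
    obtain Q where Q: "Q \<in> I" "degree_le \<alpha> Q" "d = coefficient Q \<alpha>" using d by blast
    have "(\<lambda>z. P z + Q z) \<in> I" "degree_le \<alpha> (\<lambda>z. P z + Q z)" "c + d = coefficient (\<lambda>z. P z + Q z) \<alpha>"
      using P Q ideal_ops by (simp_all add: coeff_add ideal_add degree_le_add)
    then show ?thesis by blast
  qed
  have L_H: "?L \<subseteq> H" using expansion(2) ideal_ops by blast
  have "ideal ?L (subalg_ring H)"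
  proof (rule idealI[OF R.ring_axioms])
    show "subgroup ?L (add_monoid (subalg_ring H))"
    proof
      show "?L \<subseteq> carrier (add_monoid (subalg_ring H))" using L_H by simp
      show "\<one>\<^bsub>add_monoid (subalg_ring H)\<^esub> \<in> ?L"
        using zero_in_ideal by (auto simp: degree_le_def coeff_zero intro!: exI[of _ "\<lambda>_. 0"])
      show "c \<otimes>\<^bsub>add_monoid (subalg_ring H)\<^esub> d \<in> ?L" if "c \<in> ?L" "d \<in> ?L" for c d
        using L_add[OF that] by simp
      fix c assume c: "c \<in> ?L"
      then have "- c \<in> ?L" using L_scale[OF H_closed(3), of c] by simp
      moreover have "\<ominus>\<^bsub>subalg_ring H\<^esub> c = - c"
        using c \<open>- c \<in> ?L\<close> L_H by (intro R.minus_equality) auto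
      ultimately show "inv\<^bsub>add_monoid (subalg_ring H)\<^esub> c \<in> ?L" by (simp add: a_inv_def)
    qed
    fix c h assume "c \<in> ?L" "h \<in> carrier (subalg_ring H)"
    with L_scale[of h c] show "h \<otimes>\<^bsub>subalg_ring H\<^esub> c \<in> ?L" "c \<otimes>\<^bsub>subalg_ring H\<^esub> h \<in> ?L"
      by (simp_all add: mult.commute)
  qed
  moreover have "?G \<subseteq> ?L"
  proof
    fix c assume "c \<in> ?G"
    then obtain P \<gamma> where P: "P \<in> I" "c = op_lead_coeff lt \<iota> P" "\<alpha> = op_exp lt \<iota> P + \<gamma>" by blast
    from shift_in_ideal[OF P(1) degree_le_op_exp[OF ideal_ops[OF P(1)]], of \<gamma>] P(2,3)
    show "c \<in> ?L" by (auto simp: op_lead_coeff_def) metis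
  qed
  ultimately show "coeff_ideal lt \<iota> H \<alpha> I \<subseteq> ?L"
    unfolding coeff_ideal_def by (rule R.genideal_minimal)
  have G_H: "?G \<subseteq> carrier (subalg_ring H)"
    using expansion(2) ideal_ops by (auto simp: op_lead_coeff_def)
  show "?L \<subseteq> coeff_ideal lt \<iota> H \<alpha> I"
  proof
    fix c assume "c \<in> ?L"
    then obtain P where P: "P \<in> I" "degree_le \<alpha> P" "c = coefficient P \<alpha>" by blast
    show "c \<in> coeff_ideal lt \<iota> H \<alpha> I"
    proof (cases "c = 0")
      case True
      interpret C: ideal "coeff_ideal lt \<iota> H \<alpha> I" "subalg_ring H"
        unfolding coeff_ideal_def by (rule R.genideal_ideal[OF G_H])
      show ?thesis using C.zero_closed True by simp
    next
      case False
      then have "op_exp lt \<iota> P = \<alpha>" using op_exp_eqI ideal_ops P by blast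
      moreover have "P \<noteq> (\<lambda>_. 0)" using False P(3) by (auto simp: coeff_zero)
      ultimately have "c \<in> ?G"
        using P by (auto simp: op_lead_coeff_def intro!: exI[of _ P] exI[of _ 0])
      then show ?thesis unfolding coeff_ideal_def using R.genideal_self[OF G_H] by blast
    qed
  qed
qed

lemma monic_in_ideal_iff:
  "\<alpha> \<in> Exp_set lt \<iota> I \<and> coeff_ideal lt \<iota> H \<alpha> I = H \<longleftrightarrow> (\<exists>P\<in>I. degree_le \<alpha> P \<and> coefficient P \<alpha> = 1)"
proof
  assume "\<alpha> \<in> Exp_set lt \<iota> I \<and> coeff_ideal lt \<iota> H \<alpha> I = H"
  then have "1 \<in> coeff_ideal lt \<iota> H \<alpha> I" using H_closed(2) by simp
  then show "\<exists>P\<in>I. degree_le \<alpha> P \<and> coefficient P \<alpha> = 1" unfolding coeff_ideal_eq by force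
next
  assume "\<exists>P\<in>I. degree_le \<alpha> P \<and> coefficient P \<alpha> = 1"
  then obtain P where P: "P \<in> I" "degree_le \<alpha> P" "coefficient P \<alpha> = 1" by blast
  have "P \<noteq> (\<lambda>_. 0)" using P(3) by (auto simp: coeff_zero)
  moreover have "op_exp lt \<iota> P = \<alpha>" using op_exp_eqI ideal_ops P by simp
  ultimately have "\<alpha> \<in> Exp_set lt \<iota> I" using P(1) by (auto simp: Exp_set_def)
  moreover have "h \<in> coeff_ideal lt \<iota> H \<alpha> I" if "h \<in> H" for h
    unfolding coeff_ideal_eq using that P ideal_scale degree_le_scale ideal_ops
    by (auto simp: coeff_scale intro!: exI[of _ "\<lambda>z. h * P z"])
  moreover have "coeff_ideal lt \<iota> H \<alpha> I \<subseteq> H"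
    unfolding coeff_ideal_eq using expansion(2) ideal_ops by blast
  ultimately show "\<alpha> \<in> Exp_set lt \<iota> I \<and> coeff_ideal lt \<iota> H \<alpha> I = H" by blast
qed

section \<open>Finite generation of the quotient\<close>

abbreviation "\<M> \<equiv> quotient_module \<iota> H I"

sublocale M: module "subalg_ring H" \<M>
  by (rule module_quotient_module[OF H_subring left_ideal_axioms])

abbreviation "cls P \<equiv> I +>\<^bsub>\<D>\<^esub> P"

lemma carrier_quotient: "carrier \<M> = cls ` carrier \<D>"
  by (auto simp: quotient_module_def A_RCOSETS_def')

lemma abelian_subgroup_ideal: "abelian_subgroup I \<D>"
  by (rule abelian_subgroupI3) (rule is_additive_subgroup, rule abelian_group_axioms)

lemma cls_add:
  assumes "P \<in> carrier \<D>" "Q \<in> carrier \<D>"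
  shows "cls P \<oplus>\<^bsub>\<M>\<^esub> cls Q = cls (\<lambda>z. P z + Q z)"
  using abelian_subgroup.a_rcos_sum[OF abelian_subgroup_ideal assms]
  by (simp add: quotient_module_def)

lemma cls_eqI:
  assumes "P \<in> I" "Q \<in> carrier \<D>"
  shows "cls (\<lambda>z. P z + Q z) = cls Q"
proof -
  have "(\<lambda>z. P z + Q z) \<in> cls Q" using assms(1) by (auto simp: a_r_coset_def')
  from a_repr_independence[OF this assms(2) a_subgroup] show ?thesis by (rule sym)
qed

lemma cls_ideal:
  assumes "P \<in> I"
  shows "cls P = \<zero>\<^bsub>\<M>\<^esub>"
proof -
  have "cls P = I" using a_coset_join2[OF ideal_ops[OF assms] a_subgroup assms] .
  then show ?thesis by (simp add: quotient_module_def)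
qed

lemma cls_eqD:
  assumes "P \<in> carrier \<D>" "cls P = cls Q"
  shows "\<exists>R\<in>I. \<forall>z. P z = R z + Q z"
proof -
  have "P \<in> cls Q" using abelian_subgroup.a_rcos_self[OF abelian_subgroup_ideal assms(1)] assms(2) by simp
  then show ?thesis by (auto simp: a_r_coset_def')
qed

lemma cls_scale:
  assumes "h \<in> H" "P \<in> carrier \<D>"
  shows "h \<odot>\<^bsub>\<M>\<^esub> cls P = cls (\<lambda>z. h * P z)"
proof -
  have "cls ((*) h \<otimes>\<^bsub>\<D>\<^esub> Q) = cls (\<lambda>z. h * P z)" if "Q \<in> cls P" for Q
  proof -
    obtain R where R: "R \<in> I" "Q = (\<lambda>z. R z + P z)" using \<open>Q \<in> cls P\<close> by (auto simp: a_r_coset_def')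
    have "(*) h \<otimes>\<^bsub>\<D>\<^esub> Q = (\<lambda>z. h * R z + h * P z)" by (auto simp: R(2) ring_distribs)
    then show ?thesis
      using cls_eqI[OF ideal_scale[OF assms(1) R(1)] ops_scale[OF assms]] by simp
  qed
  moreover have "P \<in> cls P" by (rule abelian_subgroup.a_rcos_self[OF abelian_subgroup_ideal assms(2)])
  ultimately have "(\<Union>Q\<in>cls P. cls ((*) h \<otimes>\<^bsub>\<D>\<^esub> Q)) = cls (\<lambda>z. h * P z)" by blast
  then show ?thesis by (simp only: quotient_module_def module.simps)
qed

lemma finitely_generated_iff:
  "finitely_generated_module (subalg_ring H) \<M> \<longleftrightarrow>
    (\<exists>S. finite S \<and> S \<subseteq> carrier \<M> \<and> carrier \<M> \<subseteq> M.lin_span S)"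
  unfolding finitely_generated_module_def M.lin_span_def by (auto simp: subset_iff image_iff)

text \<open>
  The submodules \<open>N k\<close> of classes of combinations of \<open>\<partial>\<^sub>i\<^sup>j\<close> with \<open>j < k\<close> become stationary. As the
  chain starts with \<open>N 0 = 0\<close>, the exponent found may be \<open>0\<close>, namely when \<open>I\<close> is all of \<open>\<D>\<close>.
\<close>

lemma monic_if_finitely_generated:
  assumes noeth: "noetherian_ring (subalg_ring H)"
    and fg: "finitely_generated_module (subalg_ring H) \<M>"
  shows "\<exists>a. \<exists>P\<in>I. degree_le (axis i a) P \<and> coefficient P (axis i a) = 1"
proof -
  define low_ops where "low_ops k = {P \<in> carrier \<D>. \<forall>\<beta>. coefficient P \<beta> \<noteq> 0 \<longrightarrow> (\<exists>j<k. \<beta> = axis i j)}" for k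
  define N where "N k = cls ` low_ops k" for k
  obtain S where S: "finite S" "S \<subseteq> carrier \<M>" "carrier \<M> \<subseteq> M.lin_span S"
    using fg finitely_generated_iff by blast
  have low_ops_scale: "(\<lambda>z. h * P z) \<in> low_ops k" if "h \<in> H" "P \<in> low_ops k" for h P k
    using that by (auto simp: low_ops_def coeff_scale ops_scale)
  have low_ops_add: "(\<lambda>z. P z + Q z) \<in> low_ops k" if "P \<in> low_ops k" "Q \<in> low_ops k" for P Q k
    using that by (auto simp: low_ops_def coeff_add ops_add) (metis add_0)
  have low_ops_D: "P \<in> carrier \<D>" if "P \<in> low_ops k" for P k using that by (simp add: low_ops_def)
  have N_carrier: "N k \<subseteq> carrier \<M>" for k
    using low_ops_D by (auto simp: N_def carrier_quotient)
  have "submodule (N k) (subalg_ring H) \<M>" for k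
  proof (rule M.submoduleI[OF N_carrier])
    have "(\<lambda>_. 0) \<in> low_ops k"
      using ideal_ops[OF zero_in_ideal] by (simp add: low_ops_def coeff_zero)
    then show "\<zero>\<^bsub>\<M>\<^esub> \<in> N k" using cls_ideal[OF zero_in_ideal] by (force simp: N_def)
    show smult: "h \<odot>\<^bsub>\<M>\<^esub> x \<in> N k" if "h \<in> carrier (subalg_ring H)" "x \<in> N k" for h x
      using that low_ops_scale low_ops_D by (auto simp: N_def cls_scale)
    show "x \<oplus>\<^bsub>\<M>\<^esub> y \<in> N k" if "x \<in> N k" "y \<in> N k" for x y
      using that low_ops_add low_ops_D by (auto simp: N_def cls_add)
    show "\<ominus>\<^bsub>\<M>\<^esub> x \<in> N k" if "x \<in> N k" for x
    proof -
      have "x \<in> carrier \<M>" using that N_carrier by blast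
      from M.minus_eq_smult[OF this] smult[OF M.R.a_inv_closed[OF M.R.one_closed] that]
      show ?thesis by (simp only:)
    qed
  qed
  moreover have "low_ops j \<subseteq> low_ops k" if "j \<le> k" for j k
    unfolding low_ops_def using that by (blast intro: less_le_trans)
  then have "mono N"
    unfolding N_def by (intro monoI image_mono)
  moreover have "N k \<subseteq> M.lin_span S" for k using N_carrier S(3) by blast
  ultimately obtain k where k: "\<And>l. N l \<subseteq> N k"
    using M.ascending_submodules_stable[OF noeth S(1,2)] by metis
  let ?d = "fract_derivs \<iota> (axis i k)"
  have "?d \<in> low_ops (Suc k)" by (auto simp: low_ops_def ops_fract_derivs coeff_fract_derivs)
  then have "cls ?d \<in> N k" using k[of "Suc k"] by (auto simp: N_def)
  then obtain P where P: "P \<in> low_ops k" "cls ?d = cls P" by (auto simp: N_def)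
  then obtain Q where Q: "Q \<in> I" "\<And>z. ?d z = Q z + P z"
    using cls_eqD[OF ops_fract_derivs] by blast
  have "coefficient ?d = (\<lambda>\<beta>. coefficient Q \<beta> + coefficient P \<beta>)"
    using coeff_add[OF ideal_ops[OF Q(1)] low_ops_D[OF P(1)]] Q(2) by presburger
  then have Qd: "coefficient Q \<beta> = of_bool (\<beta> = axis i k) - coefficient P \<beta>" for \<beta>
    by (simp add: coeff_fract_derivs fun_eq_iff algebra_simps)
  have "degree_le (axis i k) Q"
    using P(1) ord.axis_less by (auto simp: degree_le_def Qd low_ops_def)
  moreover have "coefficient P (axis i k) = 0"
    using P(1) by (auto simp: low_ops_def axis_eq_axis)
  then have "coefficient Q (axis i k) = 1" by (simp add: Qd)
  ultimately show ?thesis using Q(1) by blast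
qed

text \<open>
  Division with remainder. For every exponent \<open>\<alpha>\<close> there is a monic operator with exponent \<open>\<alpha>\<close> whose
  class is known to lie in the span: \<open>\<partial>\<^sup>\<alpha>\<close> itself inside the box, and a member of \<open>I\<close> outside of it.
  Subtracting a multiple of it lowers the exponent of any operator of degree at most \<open>\<alpha>\<close>.
\<close>

lemma finitely_generated_if_monic:
  assumes monic: "\<And>i. \<exists>a. \<exists>P\<in>I. degree_le (axis i a) P \<and> coefficient P (axis i a) = 1"
  shows "finitely_generated_module (subalg_ring H) \<M>"
proof -
  obtain a where a: "\<And>i. \<exists>P\<in>I. degree_le (axis i (a i)) P \<and> coefficient P (axis i (a i)) = 1"
    using monic by metis
  define S where "S = (\<lambda>\<alpha>. cls (fract_derivs \<iota> \<alpha>)) ` {\<alpha>. \<forall>i. \<alpha> $ i < a i}"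
  have S: "finite S" "S \<subseteq> carrier \<M>"
    using finite_multi_index_box ops_fract_derivs by (auto simp: S_def carrier_quotient)
  note sub = M.lin_span_submodule[OF S]
  have zero: "\<zero>\<^bsub>\<M>\<^esub> \<in> M.lin_span S"
    using subgroup.one_closed[OF submodule.axioms(1)[OF sub]] by simp
  have reducer: "\<exists>Q\<in>carrier \<D>. degree_le \<alpha> Q \<and> coefficient Q \<alpha> = 1 \<and> cls Q \<in> M.lin_span S" for \<alpha>
  proof (cases "\<forall>i. \<alpha> $ i < a i")
    case True
    then have "cls (fract_derivs \<iota> \<alpha>) \<in> M.lin_span S"
      by (intro M.lin_span_base[OF S]) (auto simp: S_def)
    then show ?thesis
      using ops_fract_derivs by (auto simp: degree_le_def coeff_fract_derivs intro!: bexI[of _ "fract_derivs \<iota> \<alpha>"])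
  next
    case False
    then obtain i where i: "a i \<le> \<alpha> $ i" by (auto simp: not_less)
    then have \<alpha>: "\<alpha> = axis i (a i) + (\<alpha> - axis i (a i))" by (auto simp: vec_eq_iff axis_def)
    obtain P where P: "P \<in> I" "degree_le (axis i (a i)) P" "coefficient P (axis i (a i)) = 1"
      using a by blast
    from shift_in_ideal[OF P(1,2), of "\<alpha> - axis i (a i)"] \<alpha> P(3)
    obtain Q where "Q \<in> I" "degree_le \<alpha> Q" "coefficient Q \<alpha> = 1" by auto
    then show ?thesis using cls_ideal zero ideal_ops by auto
  qed
  have main: "cls P \<in> M.lin_span S" if "P \<in> carrier \<D>" "degree_le \<alpha> P" for \<alpha> P
    using that
  proof (induction \<alpha> arbitrary: P rule: ord.less_induct)
    case (less \<alpha>)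
    obtain Q where Q: "Q \<in> carrier \<D>" "degree_le \<alpha> Q" "coefficient Q \<alpha> = 1" "cls Q \<in> M.lin_span S"
      using reducer by blast
    define c where "c = coefficient P \<alpha>"
    define R where "R = (\<lambda>z. P z + (- c) * Q z)"
    have c: "c \<in> H" "- c \<in> H"
      using expansion(2)[OF less.prems(1)] H_closed(5)[OF H_closed(3)] by (auto simp: c_def)
    have R: "R \<in> carrier \<D>"
      unfolding R_def by (intro ops_add less.prems ops_scale c Q)
    have R_deg: "degree_le \<alpha> R"
      unfolding R_def by (intro degree_le_add degree_le_scale less.prems ops_scale c Q)
    have "coefficient R \<alpha> = 0"
      unfolding R_def coeff_add[OF less.prems(1) ops_scale[OF c(2) Q(1)]] coeff_scale[OF Q(1)]
      by (simp add: Q(3) c_def)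
    have "cls R \<in> M.lin_span S"
    proof (cases "R = (\<lambda>_. 0)")
      case True
      then show ?thesis using cls_ideal[OF zero_in_ideal] zero by simp
    next
      case False
      from coeff_op_exp_nonzero[OF R False] R_deg \<open>coefficient R \<alpha> = 0\<close>
      have "lt (op_exp lt \<iota> R) \<alpha>" by (auto simp: degree_le_def)
      from less.IH[OF this R degree_le_op_exp[OF R]] show ?thesis .
    qed
    moreover have "c \<odot>\<^bsub>\<M>\<^esub> cls Q \<in> M.lin_span S"
      using M.submoduleE(4)[OF sub] c(1) Q(4) by simp
    moreover have "cls R \<oplus>\<^bsub>\<M>\<^esub> c \<odot>\<^bsub>\<M>\<^esub> cls Q = cls P"
    proof -
      have "cls R \<oplus>\<^bsub>\<M>\<^esub> c \<odot>\<^bsub>\<M>\<^esub> cls Q = cls (\<lambda>z. R z + c * Q z)"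
        using R Q(1) c(1) by (simp add: cls_scale cls_add ops_scale)
      then show ?thesis by (simp add: R_def)
    qed
    ultimately show ?case using M.submoduleE(5)[OF sub] by metis
  qed
  have "carrier \<M> \<subseteq> M.lin_span S"
    using main degree_le_op_exp by (auto simp: carrier_quotient)
  then show ?thesis using S finitely_generated_iff by blast
qed

end

theorem theorem31:
  fixes \<iota> :: "'n::finite \<Rightarrow> 'v::finite"
    and H :: "('k::field_char_0, 'v) mfps fract set"
    and lt :: "nat ^ 'n \<Rightarrow> nat ^ 'n \<Rightarrow> bool"
    and I :: "(('k, 'v) mfps fract \<Rightarrow> ('k, 'v) mfps fract) set"
  assumes "inj \<iota>"
    and "subring H ring_of_type_algebra"
    and "range (\<lambda>c. Fract (mfps_const c) 1) \<subseteq> H"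
    and "noetherian_ring (subalg_ring H)"
    and "\<And>i h. h \<in> H \<Longrightarrow> fract_deriv (\<iota> i) h \<in> H"
    and "monomial_order lt"
    and "left_ideal I (diff_ops \<iota> H)"
  shows "finitely_generated_module (subalg_ring H) (quotient_module \<iota> H I) \<longleftrightarrow>
    (\<forall>i. \<exists>a. axis i a \<in> Exp_set lt \<iota> I \<and> coeff_ideal lt \<iota> H (axis i a) I = H)"
proof -
  interpret operator_left_ideal I \<iota> H lt
    by (intro operator_left_ideal.intro operator_left_ideal_axioms.intro assms)
  show ?thesis
    unfolding monic_in_ideal_iff
    using monic_if_finitely_generated[OF assms(4)] finitely_generated_if_monic by blast
qed

end
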